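(* There exists a transcendental meromorphic function $f$ on $\mathbb{C}$ which has an escaping wandering domain $U$ with the following two properties. (i) For all sufficiently large $n$, $f^n(U)\supset A(r_n,R_n)$, where $0<r_n<R_n$ are real numbers with $R_n/r_n\to\infty$ $(n\to\infty)$ and $r_n\to\infty$ $(n\to\infty)$. (ii) For any two points $a,b\in U$ there exists $M>1$ such that for all sufficiently large $n$, $$M^{-1}|f^n(a)|\leq |f^n(b)|\leq M|f^n(a)|.$$
   Context: For a meromorphic function $f$ on $\mathbb{C}$ that is not a Möbius transformation, $f^n$ denotes the $n$th iterate. The Fatou set $F(f)$ is the set of points $z\in\hat{\mathbb{C}}$ such that $\{f^n\}_{n\in\mathbb{N}}$ is well-defined and forms a normal family in some neighborhood of $z$. A Fatou component is a connected component $U$ of $F(f)$; $U_n$ denotes the component of $F(f)$ with $f^n(U)\subseteq U_n$. A Fatou component $U$ is escaping if $f^n|_U\to\infty$ as $n\to\infty$. It is a wandering domain if $U_m\neq U_n$ for any pair of positive integers $m\neq n$. For $0<r<R$, $A(r,R)=\{z:\ r<|z|<R\}$. *)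

theory Defs
  imports "HOL-Complex_Analysis.Complex_Analysis"
begin

section \<open>The Riemann sphere\<close>

text \<open>The sphere is the one-point compactification of the plane; \<open>None\<close> is the point at infinity.\<close>

type_synonym sphere = "complex option"

abbreviation sphere_topology :: "sphere topology" where
  "sphere_topology \<equiv> Alexandroff_compactification euclidean"

text \<open>Inverse stereographic projection onto the unit sphere of \<open>\<complex> \<times> \<real>\<close>. The Euclidean distance of
  the images of two points is their chordal distance: \<open>2 |z - w| / (sqrt (1 + |z|^2) sqrt (1 + |w|^2))\<close>
  for finite \<open>z\<close>, \<open>w\<close>, and \<open>2 / sqrt (1 + |z|^2)\<close> between \<open>z\<close> and infinity.\<close>

definition stereo :: "sphere \<Rightarrow> complex \<times> real" where
  "stereo x = (case x of
      None \<Rightarrow> (0, 1)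
    | Some z \<Rightarrow> (2 * z / of_real (1 + (cmod z)\<^sup>2), ((cmod z)\<^sup>2 - 1) / (1 + (cmod z)\<^sup>2)))"

text \<open>Locally uniform convergence with respect to the chordal metric. The sphere is locally compact, so
  for open \<open>W\<close> this is uniform convergence on the compact subsets of \<open>W\<close>.\<close>

definition converges_loc_unif :: "sphere set \<Rightarrow> (nat \<Rightarrow> sphere \<Rightarrow> sphere) \<Rightarrow> (sphere \<Rightarrow> sphere) \<Rightarrow> bool" where
  "converges_loc_unif W F g \<longleftrightarrow>
     (\<forall>K. compactin sphere_topology K \<and> K \<subseteq> W \<longrightarrow>
        uniform_limit K (\<lambda>n x. stereo (F n x)) (\<lambda>x. stereo (g x)) sequentially)"

definition normal_family :: "sphere set \<Rightarrow> (sphere \<Rightarrow> sphere) set \<Rightarrow> bool" where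
  "normal_family W \<F> \<longleftrightarrow>
     (\<forall>F. range F \<subseteq> \<F> \<longrightarrow>
        (\<exists>(\<sigma>::nat \<Rightarrow> nat) g. strict_mono \<sigma> \<and> converges_loc_unif W (F \<circ> \<sigma>) g))"

section \<open>Meromorphic functions and their iterates\<close>

definition rational_function :: "(complex \<Rightarrow> complex) \<Rightarrow> bool" where
  "rational_function f \<longleftrightarrow>
     (\<exists>p q :: complex poly. q \<noteq> 0 \<and> (\<forall>z. poly q z \<noteq> 0 \<longrightarrow> f z = poly p z / poly q z))"

definition transcendental_meromorphic :: "(complex \<Rightarrow> complex) \<Rightarrow> bool" where
  "transcendental_meromorphic f \<longleftrightarrow> f nicely_meromorphic_on UNIV \<and> \<not> rational_function f"

text \<open>The map into the sphere given by a function that is \<open>nicely_meromorphic_on UNIV\<close> (such a function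
  has the dummy value 0 at its poles). A rational function also has a value at infinity; a transcendental
  one does not, so there the value of \<open>sphere_map\<close> at \<open>None\<close> is irrelevant.\<close>

definition sphere_map :: "(complex \<Rightarrow> complex) \<Rightarrow> sphere \<Rightarrow> sphere" where
  "sphere_map f x = (case x of
      Some z \<Rightarrow> (if is_pole f z then None else Some (f z))
    | None \<Rightarrow> (if filterlim f at_infinity at_infinity then None else Some (Lim at_infinity f)))"

definition sphere_dom :: "(complex \<Rightarrow> complex) \<Rightarrow> sphere set" where
  "sphere_dom f = (if rational_function f then UNIV else range Some)"

definition iter :: "(complex \<Rightarrow> complex) \<Rightarrow> nat \<Rightarrow> sphere \<Rightarrow> sphere" where
  "iter f n = sphere_map f ^^ n"

definition iter_defined :: "(complex \<Rightarrow> complex) \<Rightarrow> nat \<Rightarrow> sphere \<Rightarrow> bool" where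
  "iter_defined f n x \<longleftrightarrow> (\<forall>k<n. iter f k x \<in> sphere_dom f)"

section \<open>Fatou components\<close>

definition Fatou_set :: "(complex \<Rightarrow> complex) \<Rightarrow> sphere set" where
  "Fatou_set f = {x. \<exists>W. openin sphere_topology W \<and> x \<in> W \<and>
      (\<forall>n\<ge>1. \<forall>w\<in>W. iter_defined f n w) \<and> normal_family W (iter f ` {1..})}"

definition Fatou_components :: "(complex \<Rightarrow> complex) \<Rightarrow> sphere set set" where
  "Fatou_components f = connected_components_of (subtopology sphere_topology (Fatou_set f))"

definition image_component :: "(complex \<Rightarrow> complex) \<Rightarrow> sphere set \<Rightarrow> nat \<Rightarrow> sphere set" where
  "image_component f U n = (THE V. V \<in> Fatou_components f \<and> iter f n ` U \<subseteq> V)"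

definition escaping :: "(complex \<Rightarrow> complex) \<Rightarrow> sphere set \<Rightarrow> bool" where
  "escaping f U \<longleftrightarrow> converges_loc_unif U (iter f) (\<lambda>_. None)"

definition wandering_domain :: "(complex \<Rightarrow> complex) \<Rightarrow> sphere set \<Rightarrow> bool" where
  "wandering_domain f U \<longleftrightarrow> U \<in> Fatou_components f \<and>
     (\<forall>m\<ge>1. \<forall>n\<ge>1. m \<noteq> n \<longrightarrow> image_component f U m \<noteq> image_component f U n)"

text \<open>Used only at finite points: for transcendental \<open>f\<close> the iterates of a point of the Fatou set are
  never \<open>None\<close>, since the next iterate would be undefined.\<close>

definition sphere_abs :: "sphere \<Rightarrow> real" where
  "sphere_abs x = cmod (the x)"

definition annulus :: "real \<Rightarrow> real \<Rightarrow> complex set" where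
  "annulus r R = {z. r < cmod z \<and> cmod z < R}"

end

theory Submission
  imports Defs
begin

text \<open>On each annulus of a sequence of huge, ever wider annuli the map is nearly a dilation onto a part
  of the next annulus. The circles between the annuli are mapped into the unit disc, which is mapped
  into itself. Hence the annuli escape to infinity, and since the circles do not escape, the Fatou
  components containing different annuli are separated by circles. These components are bounded, so
  the map takes each of them onto the next one; therefore the image of the first component is the whole
  component around the next annulus, although the dilation itself covers only a part of the annulus.
  Points whose orbits enter the annuli have comparable orbits because the errors of the dilations are
  summable. By Harnack's inequality for \<open>ln |f^n|\<close> relative to the separating circles, every orbit of the
  component enters the annuli: the entering orbits stay near the logarithmic middle of the annuli, so
  the distances of nearby orbits to the circles are affected by a bounded power only.\<close>

section \<open>Harnack's inequality\<close>

text \<open>Near-dilations keep the ratio of radii of a single round annulus bounded, so the growth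
  of R_n / r_n can only come from surjectivity between components. The shape of these is unknown:
  the zeros of \<open>den n\<close> lie between the circles of radius \<open>rho n\<close> and
  \<open>rho (n + 1)\<close> but outside the middle annulus, and there the map is not controlled.
  Hence components are handled by topology alone, through sets that are open and closed in a
  connected set. They are identified without computing the Fatou set: the points of locally uniform
  escape form an open set that is also relatively closed in the Fatou set, so its components are
  Fatou components. The numbers: \<open>rho (n + 1) / rho n\<close> is 4^(n+1); \<open>lam n\<close>
  is the geometric mean of the ratios \<open>rho (n + 1) / rho n\<close> and
  \<open>rho (n + 2) / rho (n + 1)\<close>, and \<open>cent n\<close> that of \<open>rho n\<close>
  and \<open>rho (n + 1)\<close>. Multiplication by \<open>lam n\<close> thus sends centre to centre
  and leaves a factor 2 of room at both edges of the next annulus, which absorbs the errors.\<close>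

lemma harnack_aux:
  fixes u v :: complex
  assumes "0 < Re u" "0 < Re v" "2 * cmod (v - u) \<le> cmod (v + cnj u)"
  shows "Re u / 3 \<le> Re v"
proof -
  define x y d where "x = Re u" and "y = Re v" and "d = Im v - Im u"
  have "(2 * cmod (v - u))\<^sup>2 \<le> (cmod (v + cnj u))\<^sup>2"
    using assms by (intro power_mono) auto
  hence "4 * ((y - x)\<^sup>2 + d\<^sup>2) \<le> (y + x)\<^sup>2 + d\<^sup>2"
    by (simp add: cmod_power2 x_def y_def d_def power_mult_distrib)
  moreover have "4 * p \<le> q" if "4 * (p + r) \<le> q + r" "0 \<le> r" for p q r :: real
    using that by simp
  ultimately have "4 * (y - x)\<^sup>2 \<le> (y + x)\<^sup>2" using zero_le_power2 by blast
  hence "(2 * (y - x))\<^sup>2 \<le> (y + x)\<^sup>2" by (simp add: power2_eq_square algebra_simps)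
  hence "\<bar>2 * (y - x)\<bar> \<le> \<bar>y + x\<bar>" by (simp only: abs_le_square_iff)
  hence "\<bar>2 * (y - x)\<bar> \<le> y + x" using assms by (simp add: x_def y_def)
  thus ?thesis by (simp add: x_def y_def)
qed

text \<open>A logarithm of \<open>h\<close> has positive real part. Following it by the Cayley map
  centred at its value at \<open>a\<close> gives a map of the unit disc into itself fixing 0, to
  which Schwarz applies at radius 1/2. The factor 1/3 is (1 - 1/2) / (1 + 1/2).\<close>

lemma harnack:
  assumes h: "h holomorphic_on ball a s" and big: "\<And>z. z \<in> ball a s \<Longrightarrow> 1 < cmod (h z)"
    and b: "dist a b \<le> s / 2" and s: "0 < s"
  shows "ln (cmod (h a)) / 3 \<le> ln (cmod (h b))"
proof -
  have nz: "h z \<noteq> 0" if "z \<in> ball a s" for z using big[OF that] by auto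
  obtain p where p: "p holomorphic_on ball a s" "\<And>z. z \<in> ball a s \<Longrightarrow> h z = exp (p z)"
    using contractible_imp_holomorphic_log[OF h convex_imp_contractible[OF convex_ball] nz] by blast
  have ln: "ln (cmod (h z)) = Re (p z)" if "z \<in> ball a s" for z
    using p(2)[OF that] by simp
  have pos: "0 < Re (p z)" if "z \<in> ball a s" for z
    using ln_gt_zero[OF big[OF that]] ln[OF that] by simp
  have aS: "a \<in> ball a s" using s by simp
  define q where "q w = (p (a + of_real s * w) - p a) / (p (a + of_real s * w) + cnj (p a))" for w
  have inb: "a + of_real s * w \<in> ball a s" if "cmod w < 1" for w
    using that s by (simp add: dist_norm norm_mult)
  have dnz: "p z + cnj (p a) \<noteq> 0" if "z \<in> ball a s" for z
    using pos[OF that] pos[OF aS] by (auto simp: complex_eq_iff)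
  have qlt: "cmod (p z - p a) < cmod (p z + cnj (p a))" if "z \<in> ball a s" for z
  proof (rule power2_less_imp_less)
    have "0 < 4 * (Re (p z) * Re (p a))" using pos[OF that] pos[OF aS] by simp
    thus "(cmod (p z - p a))\<^sup>2 < (cmod (p z + cnj (p a)))\<^sup>2"
      unfolding cmod_power2 by (simp add: power2_diff power2_sum) 
  qed simp
  have holq: "q holomorphic_on ball 0 1"
    unfolding q_def
  proof -
    have "(\<lambda>w. a + of_real s * w) holomorphic_on ball 0 1" by (intro holomorphic_intros)
    hence "(p \<circ> (\<lambda>w. a + of_real s * w)) holomorphic_on ball 0 1"
      using p(1) by (rule holomorphic_on_compose_gen) (use inb in auto)
    hence "(\<lambda>w. p (a + of_real s * w)) holomorphic_on ball 0 1" by (simp add: o_def)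
    thus "(\<lambda>w. (p (a + of_real s * w) - p a) / (p (a + of_real s * w) + cnj (p a))) holomorphic_on ball 0 1"
      by (intro holomorphic_on_divide holomorphic_on_diff holomorphic_on_add holomorphic_on_const)
        (use dnz inb in auto)
  qed
  define \<xi> where "\<xi> = (b - a) / of_real s"
  have "cmod (b - a) \<le> s / 2" using b by (simp add: dist_norm norm_minus_commute)
  hence "cmod (b - a) / s \<le> (s / 2) / s" using s by (intro divide_right_mono) auto
  hence xi: "cmod \<xi> \<le> 1 / 2" "cmod \<xi> < 1" "b = a + of_real s * \<xi>"
    using s by (auto simp: \<xi>_def norm_divide)
  have "cmod (q \<xi>) \<le> cmod \<xi>"
  proof (rule Schwarz_Lemma(1)[OF holq])
    show "q 0 = 0" by (simp add: q_def)
    show "cmod (q w) < 1" if "cmod w < 1" for w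
      using qlt[OF inb[OF that]] dnz[OF inb[OF that]] by (simp add: q_def norm_divide)
  qed (use xi in auto)
  hence "cmod (q \<xi>) \<le> 1 / 2" using xi by linarith
  moreover have bS: "b \<in> ball a s" using b s by simp
  moreover have "cmod (q \<xi>) = cmod (p b - p a) / cmod (p b + cnj (p a))"
    unfolding q_def xi(3)[symmetric] by (rule norm_divide)
  moreover have "0 < cmod (p b + cnj (p a))" using dnz[OF bS] by simp
  ultimately have "2 * cmod (p b - p a) \<le> cmod (p b + cnj (p a))"
    by (simp add: pos_divide_le_eq)
  hence "Re (p a) / 3 \<le> Re (p b)" using pos aS bS by (intro harnack_aux) auto
  thus ?thesis using ln aS bS by simp
qed

text \<open>The factor 3 for logarithms becomes a cube for moduli. This form serves both for
  spreading escape and for bounding the distance of orbits from the circles.\<close>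

lemma harnack_cube:
  assumes h: "h holomorphic_on ball a s" and big: "\<And>z. z \<in> ball a s \<Longrightarrow> 1 < cmod (h z)"
    and b: "dist a b \<le> s / 2" and s: "0 < s" and B: "0 < B" "B ^ 3 \<le> cmod (h a)"
  shows "B \<le> cmod (h b)"
proof -
  have "ln (B ^ 3) \<le> ln (cmod (h a))"
    using B zero_less_power[OF B(1), of 3] by (subst ln_le_cancel_iff) auto
  moreover have "ln (B ^ 3) = 3 * ln B" using B by (simp add: ln_realpow)
  ultimately have "ln B \<le> ln (cmod (h b))" using harnack[OF h big b s] by linarith
  moreover have "1 < cmod (h b)" using big b s by auto
  ultimately show ?thesis using B by (subst (asm) ln_le_cancel_iff) auto
qed

section \<open>The sphere\<close>

lemma continuous_on_stereo: "continuous_on S (\<lambda>z. stereo (Some z))"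
proof -
  have "1 + (cmod z)\<^sup>2 \<noteq> 0" for z by (smt (verit) zero_le_power2)
  moreover from this have "1 + (complex_of_real (cmod z))\<^sup>2 \<noteq> 0" for z
    by (metis of_real_1 of_real_add of_real_eq_0_iff of_real_power)
  ultimately show ?thesis
    unfolding stereo_def option.case by (intro continuous_intros) auto
qed

text \<open>The exact value is 2 / sqrt (1 + |z|^2); estimating the two coordinates separately
  avoids the square root.\<close>

lemma dist_stereo_None: 
  assumes "1 \<le> cmod z"
  shows "dist (stereo (Some z)) (stereo None) \<le> 4 / cmod z"
proof -
  define x where "x = cmod z"
  have x: "1 \<le> x" "x \<le> x\<^sup>2" "0 < 1 + x\<^sup>2" using assms self_le_power[of x 2] by (auto simp: x_def)
  have eq: "(x\<^sup>2 - 1) / (1 + x\<^sup>2) - 1 = - (2 / (1 + x\<^sup>2))" using x by (simp add: field_simps)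
  have "dist (stereo (Some z)) (stereo None) = norm (2 * z / of_real (1 + x\<^sup>2), (x\<^sup>2 - 1) / (1 + x\<^sup>2) - 1)"
    by (simp add: dist_norm stereo_def x_def)
  also have "\<dots> \<le> cmod (2 * z / of_real (1 + x\<^sup>2)) + \<bar>(x\<^sup>2 - 1) / (1 + x\<^sup>2) - 1\<bar>"
    using norm_Pair_le by (metis real_norm_def)
  also have "cmod (2 * z / of_real (1 + x\<^sup>2)) = 2 * x / (1 + x\<^sup>2)"
    using x by (simp only: norm_divide norm_mult norm_of_real x_def[symmetric]) simp
  also have "\<bar>(x\<^sup>2 - 1) / (1 + x\<^sup>2) - 1\<bar> = 2 / (1 + x\<^sup>2)" unfolding eq using x by simp
  also have "2 * x / (1 + x\<^sup>2) + 2 / (1 + x\<^sup>2) \<le> 2 * x / x\<^sup>2 + 2 / x"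
    using x by (intro add_mono divide_left_mono) auto
  also have "\<dots> = 4 / x" using x by (simp add: power2_eq_square field_simps)
  finally show ?thesis by (simp add: x_def)
qed

text \<open>The last coordinate alone decides this: its gap to the north pole is 2 / (1 +
  |z|^2).\<close>

lemma stereo_near_None:
  assumes "dist (stereo (Some z)) (stereo None) < 1"
  shows "1 < cmod z"
proof -
  define x where "x = cmod z"
  have p: "0 < 1 + x\<^sup>2" by (smt (verit) zero_le_power2)
  have eq: "(x\<^sup>2 - 1) / (1 + x\<^sup>2) - 1 = - (2 / (1 + x\<^sup>2))" using p by (simp add: field_simps)
  have "dist (snd (stereo (Some z))) (snd (stereo None)) < 1"
    using dist_snd_le[of "stereo (Some z)" "stereo None"] assms by linarith
  hence "\<bar>(x\<^sup>2 - 1) / (1 + x\<^sup>2) - 1\<bar> < 1"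
    by (simp add: stereo_def dist_real_def x_def)
  hence "2 / (1 + x\<^sup>2) < 1" unfolding eq using p by simp
  hence "1\<^sup>2 < x\<^sup>2" using p by (simp add: field_simps)
  thus ?thesis unfolding x_def by (rule power2_less_imp_less) simp
qed

lemma compactin_sphere_image: "compactin sphere_topology (Some ` K) \<longleftrightarrow> compact K"
proof -
  have "homeomorphic_map euclidean (subtopology sphere_topology (range Some)) (Some :: complex \<Rightarrow> sphere)"
    using embedding_map_Some[of "euclidean :: complex topology"] by (simp add: embedding_map_def)
  from homeomorphic_map_compactness_eq[OF this, of K] show ?thesis
    by (auto simp: compactin_subtopology)
qed

lemma connectedin_sphere_image: "connectedin sphere_topology (Some ` K) \<longleftrightarrow> connected K"
proof -
  have "homeomorphic_map euclidean (subtopology sphere_topology (range Some)) (Some :: complex \<Rightarrow> sphere)"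
    using embedding_map_Some[of "euclidean :: complex topology"] by (simp add: embedding_map_def)
  from homeomorphic_map_connectedness_eq[OF this, of K] show ?thesis
    by (auto simp: connectedin_subtopology)
qed

lemma converges_loc_unif_image:
  "converges_loc_unif (Some ` W) F g \<longleftrightarrow>
     (\<forall>K. compact K \<and> K \<subseteq> W \<longrightarrow>
        uniform_limit K (\<lambda>n z. stereo (F n (Some z))) (\<lambda>z. stereo (g (Some z))) sequentially)"
    (is "?L \<longleftrightarrow> ?R")
proof -
  have eq: "uniform_limit (Some ` K) (\<lambda>n x. stereo (F n x)) (\<lambda>x. stereo (g x)) sequentially \<longleftrightarrow>
    uniform_limit K (\<lambda>n z. stereo (F n (Some z))) (\<lambda>z. stereo (g (Some z))) sequentially" for K
    by (simp add: uniform_limit_iff)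
  have "?L \<longleftrightarrow> (\<forall>K. compactin sphere_topology (Some ` K) \<and> Some ` K \<subseteq> Some ` W \<longrightarrow>
        uniform_limit (Some ` K) (\<lambda>n x. stereo (F n x)) (\<lambda>x. stereo (g x)) sequentially)"
    unfolding converges_loc_unif_def
    by (intro iffI allI impI; elim conjE subset_imageE) auto
  also have "\<dots> \<longleftrightarrow> ?R"
    unfolding eq compactin_sphere_image by (auto simp: inj_image_subset_iff)
  finally show ?thesis .
qed

section \<open>Escaping points and Fatou components\<close>

text \<open>A nicely meromorphic function has the dummy value 0 at poles, so \<open>f ^^ n\<close>
  silently continues through them. Along orbits without poles the plain iterates agree with those on
  the sphere.\<close>

definition pole_free_orbit :: "(complex \<Rightarrow> complex) \<Rightarrow> complex \<Rightarrow> bool" where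
  "pole_free_orbit f z \<longleftrightarrow> (\<forall>n. \<not> is_pole f ((f ^^ n) z))"

definition escapes_uniformly :: "(complex \<Rightarrow> complex) \<Rightarrow> complex set \<Rightarrow> bool" where
  "escapes_uniformly f W \<longleftrightarrow> (\<forall>w\<in>W. pole_free_orbit f w) \<and>
     (\<forall>B. \<forall>\<^sub>F n in sequentially. \<forall>w\<in>W. B \<le> cmod ((f ^^ n) w))"

text \<open>In general smaller than the usual escaping set: uniform escape on a neighbourhood is
  built in, which makes the set open and places it in the Fatou set.\<close>

definition escaping_points :: "(complex \<Rightarrow> complex) \<Rightarrow> complex set" where
  "escaping_points f = \<Union>{W. open W \<and> escapes_uniformly f W}"

lemma open_escaping_points: "open (escaping_points f)"
  unfolding escaping_points_def by (rule open_Union) auto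

lemma escaping_points_pole_free: "z \<in> escaping_points f \<Longrightarrow> pole_free_orbit f z"
  by (auto simp: escaping_points_def escapes_uniformly_def)

lemma escaping_pointsE:
  assumes "z \<in> escaping_points f"
  obtains W where "open W" "z \<in> W" "escapes_uniformly f W" "W \<subseteq> escaping_points f"
  using assms unfolding escaping_points_def by blast

lemma escaping_points_escape:
  assumes "z \<in> escaping_points f"
  shows "\<forall>\<^sub>F n in sequentially. B \<le> cmod ((f ^^ n) z)"
proof -
  obtain W where "z \<in> W" "escapes_uniformly f W" using assms by (rule escaping_pointsE)
  thus ?thesis unfolding escapes_uniformly_def by (blast intro: eventually_mono)
qed

lemma iter_Some:
  assumes "pole_free_orbit f z"
  shows "iter f n (Some z) = Some ((f ^^ n) z)"
  using assms by (induction n) (simp_all add: iter_def sphere_map_def pole_free_orbit_def)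

lemma iter_defined_imp_pole_free_orbit:
  assumes "\<not> rational_function f" "\<And>n. n \<ge> 1 \<Longrightarrow> iter_defined f n (Some z)"
  shows "pole_free_orbit f z"
proof -
  \<comment> \<open>Definedness at order n + 1 says that the iterate of order n is finite; a pole at
    order n would make the iterate of order n + 1 infinite.\<close>
  have fin: "iter f n (Some z) \<noteq> None" for n
    using assms(2)[of "Suc n"] assms(1) by (auto simp: iter_defined_def sphere_dom_def)
  have eq: "iter f n (Some z) = Some ((f ^^ n) z)" for n
  proof (induction n)
    case (Suc n)
    thus ?case using fin[of "Suc n"] by (auto simp: iter_def sphere_map_def split: if_splits)
  qed (simp add: iter_def)
  have "\<not> is_pole f ((f ^^ n) z)" for n
    using fin[of "Suc n"] eq[of n] by (auto simp: iter_def sphere_map_def split: if_splits)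
  thus ?thesis by (simp add: pole_free_orbit_def)
qed

lemma funpow_holomorphic:
  assumes f: "f nicely_meromorphic_on UNIV" and W: "\<And>w. w \<in> W \<Longrightarrow> pole_free_orbit f w"
  shows "(f ^^ n) holomorphic_on W"
proof (induction n)
  case (Suc n)
  have "f analytic_on {z. \<not> is_pole f z}"
    using nicely_meromorphic_on_imp_analytic_at[OF f] by (subst analytic_on_analytic_at) auto
  hence "f holomorphic_on {z. \<not> is_pole f z}" by (rule analytic_imp_holomorphic)
  with Suc have "(f \<circ> (f ^^ n)) holomorphic_on W"
    by (rule holomorphic_on_compose_gen) (use W in \<open>auto simp: pole_free_orbit_def\<close>)
  thus ?case by (simp add: o_def)
qed (simp add: holomorphic_on_id[unfolded id_def] id_def)

section \<open>Uniform escape as convergence to infinity, and normality\<close>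

lemma escapes_uniformly_limit:
  assumes "escapes_uniformly f W"
  shows "uniform_limit W (\<lambda>n z. stereo (iter f n (Some z))) (\<lambda>_. stereo None) sequentially"
proof (rule uniform_limitI)
  fix e :: real assume e: "0 < e"
  have "\<forall>\<^sub>F n in sequentially. \<forall>w\<in>W. max 1 (8 / e) \<le> cmod ((f ^^ n) w)"
    using assms unfolding escapes_uniformly_def by blast
  thus "\<forall>\<^sub>F n in sequentially. \<forall>w\<in>W. dist (stereo (iter f n (Some w))) (stereo None) < e"
  proof eventually_elim
    case (elim n)
    show ?case
    proof
      fix w assume w: "w \<in> W"
      hence b: "1 \<le> cmod ((f ^^ n) w)" "8 / e \<le> cmod ((f ^^ n) w)" using elim by auto
      have "iter f n (Some w) = Some ((f ^^ n) w)"
        using assms w by (intro iter_Some) (auto simp: escapes_uniformly_def)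
      hence "dist (stereo (iter f n (Some w))) (stereo None) \<le> 4 / cmod ((f ^^ n) w)"
        using dist_stereo_None[OF b(1)] by simp
      also have "\<dots> \<le> 4 / (8 / e)" using b e
        by (intro divide_left_mono mult_pos_pos divide_pos_pos) auto
      also have "\<dots> < e" using e by simp
      finally show "dist (stereo (iter f n (Some w))) (stereo None) < e" .
    qed
  qed
qed

lemma uniform_limit_local_imp_compact:
  assumes "compact K" "\<And>x. x \<in> K \<Longrightarrow> \<exists>W. open W \<and> x \<in> W \<and> uniform_limit W F g sequentially"
  shows "uniform_limit K F g sequentially"
proof -
  define \<W> where "\<W> = {W. open W \<and> uniform_limit W F g sequentially}"
  have "K \<subseteq> \<Union>\<W>" "\<And>W. W \<in> \<W> \<Longrightarrow> open W" using assms(2) by (auto simp: \<W>_def)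
  then obtain \<D> where D: "\<D> \<subseteq> \<W>" "finite \<D>" "K \<subseteq> \<Union>\<D>"
    using compactE[OF assms(1)] by metis
  have "uniform_limit (\<Union>\<D>) F g sequentially"
  proof (rule uniform_limitI)
    fix e :: real assume e: "0 < e"
    have "\<forall>\<^sub>F n in sequentially. \<forall>W\<in>\<D>. \<forall>x\<in>W. dist (F n x) (g x) < e"
    proof (rule eventually_ball_finite[OF D(2)], rule)
      fix W assume "W \<in> \<D>"
      hence "uniform_limit W F g sequentially" using D(1) by (auto simp: \<W>_def)
      thus "\<forall>\<^sub>F n in sequentially. \<forall>x\<in>W. dist (F n x) (g x) < e" using e by (rule uniform_limitD)
    qed
    thus "\<forall>\<^sub>F n in sequentially. \<forall>x\<in>\<Union>\<D>. dist (F n x) (g x) < e"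
      by eventually_elim auto
  qed
  thus ?thesis using D by (blast intro: uniform_limit_on_subset)
qed

lemma escaping_points_converge:
  assumes "C \<subseteq> escaping_points f"
  shows "escaping f (Some ` C)"
  unfolding escaping_def converges_loc_unif_image
proof (intro allI impI, elim conjE)
  fix K assume K: "compact K" "K \<subseteq> C"
  show "uniform_limit K (\<lambda>n z. stereo (iter f n (Some z))) (\<lambda>z. stereo None) sequentially"
    using K(1)
  proof (rule uniform_limit_local_imp_compact)
    fix x assume "x \<in> K"
    hence "x \<in> escaping_points f" using K assms by blast
    thus "\<exists>W. open W \<and> x \<in> W \<and> uniform_limit W (\<lambda>n z. stereo (iter f n (Some z))) (\<lambda>z. stereo None) sequentially"
      by (rule escaping_pointsE) (blast intro: escapes_uniformly_limit)
  qed
qed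

text \<open>A sequence of iterates either repeats one order infinitely often, which gives a constant
  subsequence, or its orders tend to infinity, and then the whole sequence converges to
  infinity.\<close>

lemma escapes_uniformly_normal:
  assumes "escapes_uniformly f W"
  shows "normal_family (Some ` W) (iter f ` {1..})"
  unfolding normal_family_def
proof (intro allI impI)
  fix F :: "nat \<Rightarrow> sphere \<Rightarrow> sphere" assume "range F \<subseteq> iter f ` {1..}"
  hence "\<exists>k. F j = iter f k" for j by blast
  then obtain k where k: "F j = iter f (k j)" for j by metis
  show "\<exists>(\<sigma>::nat \<Rightarrow> nat) g. strict_mono \<sigma> \<and> converges_loc_unif (Some ` W) (F \<circ> \<sigma>) g"
  proof (cases "\<exists>m. infinite {j. k j = m}")
    case True
    then obtain m where m: "infinite {j. k j = m}" by blast
    then obtain \<sigma> :: "nat \<Rightarrow> nat" where s: "strict_mono \<sigma>" "\<And>n. \<sigma> n \<in> {j. k j = m}"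
      using infinite_enumerate by blast
    have "converges_loc_unif (Some ` W) (F \<circ> \<sigma>) (iter f m)"
      unfolding converges_loc_unif_image using s k by (simp add: uniform_limit_iff)
    thus ?thesis using s by blast
  next
    case False
    have "filterlim k at_top sequentially"
      unfolding filterlim_at_top
    proof
      fix Z
      have "finite (\<Union>m<Z. {j. k j = m})" using False by blast
      moreover have "(\<Union>m<Z. {j. k j = m}) = {j. \<not> Z \<le> k j}" by auto
      ultimately have "finite {j. \<not> Z \<le> k j}" by simp
      thus "\<forall>\<^sub>F j in sequentially. Z \<le> k j"
        by (simp flip: cofinite_eq_sequentially add: eventually_cofinite)
    qed
    hence "uniform_limit W (\<lambda>n z. stereo (iter f (k n) (Some z))) (\<lambda>_. stereo None) sequentially"
      using filterlim_compose[OF escapes_uniformly_limit[OF assms]] by blast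
    hence "converges_loc_unif (Some ` W) (F \<circ> (\<lambda>n. n)) (\<lambda>_. None)"
      unfolding converges_loc_unif_image o_def k by (blast intro: uniform_limit_on_subset)
    moreover have "strict_mono (\<lambda>n::nat. n)" by (simp add: strict_mono_def)
    ultimately show ?thesis by blast
  qed
qed

lemma escaping_points_Fatou: "Some ` escaping_points f \<subseteq> Fatou_set f"
proof safe
  fix z assume "z \<in> escaping_points f"
  then obtain W where W: "open W" "z \<in> W" "escapes_uniformly f W" by (rule escaping_pointsE)
  have "iter_defined f n (Some w)" if "w \<in> W" for n w
    using W(3) that iter_Some[of f w]
    by (auto simp: iter_defined_def sphere_dom_def escapes_uniformly_def)
  thus "Some z \<in> Fatou_set f"
    unfolding Fatou_set_def using W escapes_uniformly_normal[OF W(3)]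
    by (intro CollectI exI[of _ "Some ` W"]) auto
qed

lemma Fatou_point:
  assumes "\<not> rational_function f" "x \<in> Fatou_set f"
  obtains z W where "x = Some z" "open W" "z \<in> W" "\<And>w. w \<in> W \<Longrightarrow> pole_free_orbit f w"
    "normal_family (Some ` W) (iter f ` {1..})"
proof -
  obtain V where V: "openin sphere_topology V" "x \<in> V" "\<And>n w. n \<ge> 1 \<Longrightarrow> w \<in> V \<Longrightarrow> iter_defined f n w"
      "normal_family V (iter f ` {1..})"
    using assms(2) unfolding Fatou_set_def by blast
  \<comment> \<open>The iterate of order 0 must already lie in the domain of \<open>f\<close>, which
    excludes infinity.\<close>
  have sub: "V \<subseteq> range Some"
    using V(3)[of 1] assms(1) by (auto simp: iter_defined_def iter_def sphere_dom_def)
  then obtain W where W: "open W" "V = Some ` W"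
    using V(1) by (auto simp: openin_Alexandroff_compactification)
  moreover obtain z where "x = Some z" "z \<in> W" using V(2) W by blast
  moreover have "pole_free_orbit f w" if "w \<in> W" for w
    using assms(1) V(3) that W(2) by (intro iter_defined_imp_pole_free_orbit) auto
  ultimately show ?thesis using V(4) that by blast
qed

section \<open>Escape is closed relative to the Fatou set\<close>

text \<open>The easy direction of Arzela-Ascoli: if equicontinuity failed along points tending to
  \<open>z\<close>, a subsequence of the iterates involved would converge uniformly on a closed disc
  about \<open>z\<close>, and the continuity of its limit would contradict the gap
  \<open>e\<close>.\<close>

lemma normal_imp_equicontinuous:
  assumes f: "f nicely_meromorphic_on UNIV" and W: "open W" "z \<in> W"
    and pf: "\<And>w. w \<in> W \<Longrightarrow> pole_free_orbit f w"
    and normal: "normal_family (Some ` W) (iter f ` {1..})" and e: "0 < e"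
  shows "\<exists>\<delta>>0. ball z \<delta> \<subseteq> W \<and> (\<forall>n\<ge>1. \<forall>w\<in>ball z \<delta>.
    dist (stereo (Some ((f ^^ n) w))) (stereo (Some ((f ^^ n) z))) < e)"
proof (rule ccontr)
  assume neg: "\<not> ?thesis"
  obtain r where r: "0 < r" "cball z r \<subseteq> W" using W open_contains_cball by blast
  define h where "h n w = stereo (Some ((f ^^ n) w))" for n w
  have "\<exists>n w. 1 \<le> n \<and> w \<in> ball z (r / Suc j) \<and> e \<le> dist (h n w) (h n z)" for j
  proof -
    have "r / Suc j \<le> r / 1" using r by (intro divide_left_mono) auto
    hence "ball z (r / Suc j) \<subseteq> cball z r" 
      by (intro subset_trans[OF ball_subset_cball subset_cball]) simp
    hence "ball z (r / Suc j) \<subseteq> W" using r(2) by (rule subset_trans)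
    moreover have "0 < r / Suc j" using r(1) by simp
    ultimately have "\<not> (\<forall>n\<ge>1. \<forall>w\<in>ball z (r / Suc j). dist (h n w) (h n z) < e)"
      using neg unfolding h_def by blast
    then obtain n w where "1 \<le> n" "w \<in> ball z (r / Suc j)" "\<not> dist (h n w) (h n z) < e"
      by blast
    thus ?thesis unfolding not_less by blast
  qed
  hence "\<exists>k. \<forall>j. \<exists>w. 1 \<le> k j \<and> w \<in> ball z (r / Suc j) \<and> e \<le> dist (h (k j) w) (h (k j) z)"
    by (intro choice) blast
  then obtain k where "\<forall>j. \<exists>w. 1 \<le> k j \<and> w \<in> ball z (r / Suc j) \<and> e \<le> dist (h (k j) w) (h (k j) z)"
    by blast
  hence "\<exists>\<zeta>. \<forall>j. 1 \<le> k j \<and> \<zeta> j \<in> ball z (r / Suc j) \<and> e \<le> dist (h (k j) (\<zeta> j)) (h (k j) z)"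
    by (rule choice)
  then obtain \<zeta> where k: "\<And>j. 1 \<le> k j" and zeta: "\<And>j::nat. \<zeta> j \<in> ball z (r / Suc j)"
    and far: "\<And>j. e \<le> dist (h (k j) (\<zeta> j)) (h (k j) z)"
    by blast
  have "range (\<lambda>j. iter f (k j)) \<subseteq> iter f ` {1..}" using k by auto
  then obtain \<sigma> :: "nat \<Rightarrow> nat" and g where \<sigma>: "strict_mono \<sigma>"
    and conv: "converges_loc_unif (Some ` W) ((\<lambda>j. iter f (k j)) \<circ> \<sigma>) g"
    using normal unfolding normal_family_def by blast
  define G where "G w = stereo (g (Some w))" for w
  have "uniform_limit (cball z r) (\<lambda>j w. stereo (iter f (k (\<sigma> j)) (Some w))) G sequentially"
    using conv[unfolded converges_loc_unif_image, rule_format, of "cball z r"] r(2)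
    by (simp add: G_def[abs_def])
  moreover have "stereo (iter f n (Some w)) = h n w" if "w \<in> cball z r" for n w
    using iter_Some[OF pf, of w n] r(2) that by (auto simp: h_def)
  ultimately have lim: "uniform_limit (cball z r) (\<lambda>j. h (k (\<sigma> j))) G sequentially"
    by (simp add: uniform_limit_iff)
  have conth: "continuous_on (cball z r) (h n)" for n
  proof -
    have "continuous_on (cball z r) (f ^^ n)"
      using f pf r(2) by (intro holomorphic_on_imp_continuous_on funpow_holomorphic) auto
    thus ?thesis unfolding h_def by (rule continuous_on_compose2[OF continuous_on_stereo[of UNIV]]) auto
  qed
  have "continuous_on (cball z r) G"
    by (rule uniform_limit_theorem[OF _ lim]) (auto simp: conth)
  moreover have zeta': "\<zeta> j \<in> cball z r" for j
  proof -
    have "r / Suc j \<le> r / 1" using r by (intro divide_left_mono) auto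
    thus ?thesis using zeta[of j] by simp
  qed
  moreover have "(\<lambda>j. \<zeta> (\<sigma> j)) \<longlonglongrightarrow> z"
  proof -
    have "(\<lambda>j. r / real (Suc j)) \<longlonglongrightarrow> 0"
      using LIMSEQ_Suc[OF lim_const_over_n[of r]] by simp
    hence "(\<lambda>j. dist (\<zeta> j) z) \<longlonglongrightarrow> 0"
      by (rule Lim_null_comparison[rotated]) (use zeta in \<open>auto simp: dist_commute less_imp_le\<close>)
    hence "\<zeta> \<longlonglongrightarrow> z" by (rule tendsto_dist_iff[THEN iffD2])
    thus ?thesis using LIMSEQ_subseq_LIMSEQ[OF _ \<sigma>] by (auto simp: o_def)
  qed
  ultimately have "(\<lambda>j. G (\<zeta> (\<sigma> j))) \<longlonglongrightarrow> G z"
    using r(1) by (intro continuous_on_tendsto_compose[where f=G]) auto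
  hence "\<forall>\<^sub>F j in sequentially. dist (G (\<zeta> (\<sigma> j))) (G z) < e / 3"
    using e by (intro tendstoD) auto
  moreover have "\<forall>\<^sub>F j in sequentially. \<forall>w\<in>cball z r. dist (h (k (\<sigma> j)) w) (G w) < e / 3"
    using lim e by (intro uniform_limitD) auto
  ultimately have "\<forall>\<^sub>F j in sequentially. False"
  proof eventually_elim
    case (elim j)
    have "dist (h (k (\<sigma> j)) (\<zeta> (\<sigma> j))) (G (\<zeta> (\<sigma> j))) < e / 3" "dist (h (k (\<sigma> j)) z) (G z) < e / 3"
      using elim(2) zeta' r(1) by auto
    hence "dist (h (k (\<sigma> j)) (\<zeta> (\<sigma> j))) (h (k (\<sigma> j)) z) < e"
      using elim(1) dist_triangle[of "h (k (\<sigma> j)) (\<zeta> (\<sigma> j))" "h (k (\<sigma> j)) z" "G (\<zeta> (\<sigma> j))"]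
        dist_triangle[of "G (\<zeta> (\<sigma> j))" "h (k (\<sigma> j)) z" "G z"]
      by (simp add: dist_commute)
    thus False using far[of "\<sigma> j"] by linarith
  qed
  thus False by simp
qed

text \<open>Equicontinuity keeps the iterates outside the unit disc on a fixed ball as soon as they are near
  infinity at one point of it; Harnack's inequality then spreads the escape to the whole ball. Thus no
  Montel or Vitali theorem is needed.\<close>

lemma escaping_points_closed_in_Fatou:
  assumes f: "f nicely_meromorphic_on UNIV" and nr: "\<not> rational_function f"
    and z: "Some z \<in> Fatou_set f" "z \<in> closure (escaping_points f)"
  shows "z \<in> escaping_points f"
proof -
  obtain W where W: "open W" "z \<in> W" and pf: "\<And>w. w \<in> W \<Longrightarrow> pole_free_orbit f w"
    and normal: "normal_family (Some ` W) (iter f ` {1..})"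
    by (rule Fatou_point[OF nr z(1)]) auto
  obtain \<delta> where d: "\<delta> > 0" "ball z \<delta> \<subseteq> W"
    and equi: "\<And>n w. n \<ge> 1 \<Longrightarrow> w \<in> ball z \<delta> \<Longrightarrow> dist (stereo (Some ((f ^^ n) w))) (stereo (Some ((f ^^ n) z))) < 1 / 3"
    using normal_imp_equicontinuous[OF f W pf normal, of "1/3"] by auto
  obtain a where a: "a \<in> escaping_points f" "dist a z < \<delta> / 4"
    using z(2) d(1) unfolding closure_approachable by (meson divide_pos_pos zero_less_numeral)
  have aW: "a \<in> ball z \<delta>" using a d(1) by (simp add: dist_commute)
  \<comment> \<open>The radii fit together: as \<open>a\<close> is within \<delta>/4 of
    \<open>z\<close>, the ball of radius 3\<delta>/4 about \<open>a\<close> lies in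
    \<open>ball z \<delta>\<close>, and every point of \<open>X\<close> is within \<delta>/4 +
    \<delta>/8 = 3\<delta>/8 of \<open>a\<close>, half that radius, as Harnack requires.\<close>
  define X where "X = ball z (\<delta> / 8)"
  have "escapes_uniformly f X"
    unfolding escapes_uniformly_def
  proof (intro conjI allI)
    show "\<forall>w\<in>X. pole_free_orbit f w" 
    proof
      fix w assume "w \<in> X"
      hence "w \<in> ball z \<delta>" using d(1) by (simp add: X_def)
      thus "pole_free_orbit f w" using pf d(2) by blast
    qed
  next
    fix B :: real
    define B' where "B' = max 1 B"
    \<comment> \<open>The cube is the price of Harnack. Since 4/13 < 1/3, the chordal distances
      between the images of \<open>w\<close> and \<open>z\<close>, of \<open>z\<close> and
      \<open>a\<close>, and from that of \<open>a\<close> to infinity add up to less than 1.\<close>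
    have "\<forall>\<^sub>F n in sequentially. max (B' ^ 3) 13 \<le> cmod ((f ^^ n) a)"
      by (rule escaping_points_escape[OF a(1)])
    moreover have "\<forall>\<^sub>F n in sequentially. n \<ge> (1::nat)" by (rule eventually_ge_at_top)
    ultimately show "\<forall>\<^sub>F n in sequentially. \<forall>w\<in>X. B \<le> cmod ((f ^^ n) w)"
    proof eventually_elim
      case (elim n)
      have big: "B' ^ 3 \<le> cmod ((f ^^ n) a)" "13 \<le> cmod ((f ^^ n) a)" using elim by auto
      have "dist (stereo (Some ((f ^^ n) a))) (stereo None) \<le> 4 / cmod ((f ^^ n) a)"
        using big by (intro dist_stereo_None) auto
      also have "\<dots> \<le> 4 / 13" using big by (intro divide_left_mono) auto
      also have "\<dots> < 1 / 3" by simp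
      finally have aN: "dist (stereo (Some ((f ^^ n) a))) (stereo None) < 1 / 3" .
      have gt1: "1 < cmod ((f ^^ n) w)" if "w \<in> ball z \<delta>" for w
      proof (rule stereo_near_None)
        show "dist (stereo (Some ((f ^^ n) w))) (stereo None) < 1"
          using aN equi[OF elim(2) that] equi[OF elim(2) aW]
            dist_triangle[of "stereo (Some ((f ^^ n) w))" "stereo None" "stereo (Some ((f ^^ n) z))"]
            dist_triangle[of "stereo (Some ((f ^^ n) z))" "stereo None" "stereo (Some ((f ^^ n) a))"]
          by (simp add: dist_commute)
      qed
      have sub: "ball a (3 * \<delta> / 4) \<subseteq> ball z \<delta>"
      proof
        fix w assume "w \<in> ball a (3 * \<delta> / 4)"
        thus "w \<in> ball z \<delta>" using dist_triangle[of z w a] a(2) by (simp add: dist_commute)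
      qed
      show ?case
      proof
        fix w assume w: "w \<in> X"
        have "B' \<le> cmod ((f ^^ n) w)"
        proof (rule harnack_cube[where h = "f ^^ n" and a = a and s = "3 * \<delta> / 4"])
          show "(f ^^ n) holomorphic_on ball a (3 * \<delta> / 4)"
            using pf sub d by (intro funpow_holomorphic[OF f]) blast
          show "1 < cmod ((f ^^ n) v)" if "v \<in> ball a (3 * \<delta> / 4)" for v using gt1 sub that by blast
          show "dist a w \<le> 3 * \<delta> / 4 / 2"
            using dist_triangle[of a w z] a(2) w by (simp add: X_def)
          show "B' ^ 3 \<le> cmod ((f ^^ n) a)" by (rule big)
        qed (use d in \<open>auto simp: B'_def\<close>)
        thus "B \<le> cmod ((f ^^ n) w)" by (simp add: B'_def)
      qed
    qed
  qed
  thus ?thesis using d unfolding escaping_points_def X_def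
    by (intro UnionI[of "ball z (\<delta> / 8)"]) auto
qed

section \<open>Invariance of escape, and its components as Fatou components\<close>

lemma nonconstant_if_not_rational:
  assumes f: "f nicely_meromorphic_on UNIV" and nr: "\<not> rational_function f"
    and S: "open S" "S \<noteq> {}"
  shows "\<not> f constant_on S"
proof
  assume "f constant_on S"
  hence "f constant_on UNIV"
    using constant_on_extend_nicely_meromorphic_on[OF f, of S] S by auto
  then obtain c where "\<And>z. f z = c" by (auto simp: constant_on_def)
  hence "rational_function f"
    unfolding rational_function_def by (intro exI[of _ "[:c:]"] exI[of _ 1]) auto
  thus False using nr by blast
qed

text \<open>The open mapping theorem turns a neighbourhood of \<open>z\<close> into one of
  \<open>f z\<close>; the escape is then merely shifted by one step.\<close>

lemma escaping_points_forward:
  assumes f: "f nicely_meromorphic_on UNIV" and nr: "\<not> rational_function f"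
    and z: "z \<in> escaping_points f"
  shows "f z \<in> escaping_points f"
proof -
  obtain W where W: "open W" "z \<in> W" "escapes_uniformly f W" using z by (rule escaping_pointsE)
  obtain \<delta> where d: "\<delta> > 0" "ball z \<delta> \<subseteq> W" using W openE by blast
  have pf: "pole_free_orbit f w" if "w \<in> ball z \<delta>" for w
    using that d W(3) by (auto simp: escapes_uniformly_def)
  have "f holomorphic_on ball z \<delta>" using funpow_holomorphic[OF f pf, of "ball z \<delta>" 1] by simp
  hence op: "open (f ` ball z \<delta>)"
    by (rule open_mapping_thm) (use nonconstant_if_not_rational[OF f nr] d in auto)
  have "escapes_uniformly f (f ` ball z \<delta>)"
    unfolding escapes_uniformly_def
  proof (intro conjI allI ballI)
    fix v assume "v \<in> f ` ball z \<delta>"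
    then obtain w where w: "w \<in> ball z \<delta>" "v = f w" by blast
    have "\<not> is_pole f ((f ^^ Suc n) w)" for n using pf[OF w(1)] unfolding pole_free_orbit_def by blast
    thus "pole_free_orbit f v" by (simp add: pole_free_orbit_def w(2) funpow_swap1)
  next
    fix B
    have "\<forall>\<^sub>F n in sequentially. \<forall>w\<in>W. B \<le> cmod ((f ^^ n) w)"
      using W(3) by (simp add: escapes_uniformly_def)
    hence "\<forall>\<^sub>F n in sequentially. \<forall>w\<in>W. B \<le> cmod ((f ^^ Suc n) w)"
      by (simp only: eventually_sequentially_Suc[of "\<lambda>n. \<forall>w\<in>W. B \<le> cmod ((f ^^ n) w)"])
    thus "\<forall>\<^sub>F n in sequentially. \<forall>v\<in>f ` ball z \<delta>. B \<le> cmod ((f ^^ n) v)"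
      by eventually_elim (use d in \<open>auto simp: funpow_swap1\<close>)
  qed
  thus ?thesis using op d(1) unfolding escaping_points_def by (intro UnionI[of "f ` ball z \<delta>"]) auto
qed

text \<open>Serves to recognise a limit of preimages as an escaping point once its image is known to
  be one.\<close>

lemma escaping_points_backward:
  assumes f: "f nicely_meromorphic_on UNIV"
    and z: "\<not> is_pole f z" "f z \<in> escaping_points f"
  shows "z \<in> escaping_points f"
proof -
  obtain W where W: "open W" "f z \<in> W" "escapes_uniformly f W" using z(2) by (rule escaping_pointsE)
  have "f analytic_on {z}" using nicely_meromorphic_on_imp_analytic_at[OF f _ z(1)] by simp
  then obtain S where S: "open S" "z \<in> S" "f holomorphic_on S" by (auto simp: analytic_at)
  define X where "X = S \<inter> f -` W"
  have X: "open X" "z \<in> X" "X \<subseteq> S"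
    unfolding X_def using S W by (auto intro!: continuous_open_preimage holomorphic_on_imp_continuous_on)
  have "escapes_uniformly f X"
    unfolding escapes_uniformly_def
  proof (intro conjI allI ballI)
    fix v assume v: "v \<in> X"
    have "\<not> is_pole f ((f ^^ n) (f v))" for n
      using W(3) v by (auto simp: escapes_uniformly_def pole_free_orbit_def X_def)
    hence "\<not> is_pole f ((f ^^ Suc n) v)" for n by (simp add: funpow_swap1)
    moreover have "\<not> is_pole f v" using S v not_is_pole_holomorphic[of S v f] by (auto simp: X_def)
    ultimately show "pole_free_orbit f v"
      unfolding pole_free_orbit_def by (metis funpow_0 not0_implies_Suc)
  next
    fix B
    have "\<forall>\<^sub>F n in sequentially. \<forall>w\<in>W. B \<le> cmod ((f ^^ n) w)"
      using W(3) by (simp add: escapes_uniformly_def)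
    hence "\<forall>\<^sub>F n in sequentially. \<forall>v\<in>X. B \<le> cmod ((f ^^ Suc n) v)"
      by eventually_elim (auto simp: X_def funpow_swap1)
    thus "\<forall>\<^sub>F n in sequentially. \<forall>v\<in>X. B \<le> cmod ((f ^^ n) v)"
      by (simp only: eventually_sequentially_Suc[of "\<lambda>n. \<forall>v\<in>X. B \<le> cmod ((f ^^ n) v)"])
  qed
  thus ?thesis using X unfolding escaping_points_def by blast
qed

text \<open>The escaping points are open, and closed relative to the Fatou set. So the Fatou
  component \<open>V\<close> around \<open>C\<close>, being connected, consists of escaping points
  only and cannot be larger than \<open>C\<close>.\<close>

lemma escaping_component_Fatou_component:
  assumes f: "f nicely_meromorphic_on UNIV" and nr: "\<not> rational_function f"
    and C: "C \<in> components (escaping_points f)"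
  shows "Some ` C \<in> Fatou_components f"
proof -
  obtain z where z: "z \<in> C" using C in_components_nonempty by blast
  have sub: "C \<subseteq> escaping_points f" and conn: "connected C"
    using C by (auto dest: in_components_subset in_components_connected)
  define X where "X = subtopology sphere_topology (Fatou_set f)"
  define V where "V = connected_component_of_set X (Some z)"
  have CF: "Some ` C \<subseteq> Fatou_set f" using sub escaping_points_Fatou by blast
  have zX: "Some z \<in> topspace X" using z CF unfolding X_def by auto
  hence VX: "V \<in> connected_components_of X" by (auto simp: V_def connected_components_of_def)
  have "V \<subseteq> Fatou_set f" unfolding V_def X_def
    using connected_component_of_subset_topspace[of X] by (force simp: X_def)
  moreover have "Fatou_set f \<subseteq> range Some" using Fatou_point[OF nr] by blast
  ultimately obtain D where D: "V = Some ` D" "Some ` D \<subseteq> Fatou_set f" by (metis subset_imageE subset_trans)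
  have "connectedin X V" unfolding V_def by (rule connectedin_connected_component_of)
  hence connD: "connected D" unfolding D X_def connectedin_subtopology connectedin_sphere_image by simp
  have "connectedin X (Some ` C)"
    unfolding X_def connectedin_subtopology connectedin_sphere_image using conn CF by blast
  hence "Some ` C \<subseteq> V" unfolding V_def using z by (intro connected_component_of_maximal) auto
  hence CD: "C \<subseteq> D" unfolding D(1) by (simp add: inj_image_subset_iff)
  have cl: "D \<inter> closure (escaping_points f) \<subseteq> escaping_points f"
    using escaping_points_closed_in_Fatou[OF f nr] D(2) by blast
  have "D \<inter> - closure (escaping_points f) = {}"
  proof (rule ccontr)
    assume "D \<inter> - closure (escaping_points f) \<noteq> {}"
    moreover have "escaping_points f \<inter> D \<noteq> {}" using z sub CD by blast
    moreover have "D \<subseteq> escaping_points f \<union> - closure (escaping_points f)" using cl by blast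
    moreover have "escaping_points f \<inter> - closure (escaping_points f) \<inter> D = {}"
      using closure_subset by blast
    ultimately show False
      using connectedD[OF connD open_escaping_points, of "- closure (escaping_points f)" f] by blast
  qed
  hence "D \<subseteq> escaping_points f" using cl by blast
  hence "D \<subseteq> C" using components_maximal[OF C connD] CD z by blast
  hence "V = Some ` C" using CD D(1) by blast
  thus ?thesis using VX unfolding Fatou_components_def X_def by simp
qed

text \<open>Fatou components are disjoint, so a nonempty image leaves one candidate for the definite
  description.\<close>

lemma image_component_eq:
  assumes f: "f nicely_meromorphic_on UNIV" and nr: "\<not> rational_function f"
    and C: "C \<in> components (escaping_points f)"
    and im: "iter f n ` U \<subseteq> Some ` C" and U: "U \<noteq> {}"
  shows "image_component f U n = Some ` C"
  unfolding image_component_def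
proof (rule the_equality)
  show "Some ` C \<in> Fatou_components f \<and> iter f n ` U \<subseteq> Some ` C"
    using escaping_component_Fatou_component[OF f nr C] im by blast
  fix V assume V: "V \<in> Fatou_components f \<and> iter f n ` U \<subseteq> V"
  hence "\<not> disjnt V (Some ` C)" using im U by (auto simp: disjnt_def)
  thus "V = Some ` C"
    using V escaping_component_Fatou_component[OF f nr C]
      pairwiseD[OF pairwise_disjoint_connected_components_of]
    unfolding Fatou_components_def by metis
qed

section \<open>A map that is nearly linear on annuli\<close>

definition rho :: "nat \<Rightarrow> real" where "rho n = 2 ^ (n * (n + 1))"
definition lam :: "nat \<Rightarrow> real" where "lam n = 2 ^ (2 * n + 3)"
text \<open>Quadratic, so that \<open>2 ^ expo n\<close> outgrows \<open>rho (n + 2)\<close> with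
  room for a summable error 2^-(n+3).\<close>

definition expo :: "nat \<Rightarrow> nat" where "expo n = (n + 4)\<^sup>2"

text \<open>Multiplication by z^N turns the correction factor described below into a polynomial that
  does not vanish at 0.\<close>

definition den :: "nat \<Rightarrow> complex \<Rightarrow> complex" where
  "den n z = z ^ expo n + (z / of_real (rho (n + 1) / 2)) ^ expo n * z ^ expo n + of_real (2 * rho n) ^ expo n"

text \<open>The quotient of \<open>trm n z\<close> and \<open>lam n * z\<close> is \<open>1 / (1 + (z / \<beta>) ^ N + (\<alpha> / z) ^ N)\<close> with
  \<open>\<alpha> = 2 * rho n\<close>, \<open>\<beta> = rho (n + 1) / 2\<close> and \<open>N = expo n\<close>, which is close to 1 well between \<open>\<alpha>\<close> and \<open>\<beta>\<close>
  and small outside.\<close>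

definition trm :: "nat \<Rightarrow> complex \<Rightarrow> complex" where
  "trm n z = of_real (lam n) * z ^ Suc (expo n) / den n z"

lemma rho_pos: "0 < rho n" and lam_pos: "0 < lam n"
  by (simp_all add: rho_def lam_def)

lemma rho_Suc: "rho (Suc n) = 4 * 4 ^ n * rho n"
proof -
  have "rho (Suc n) = 2 ^ (2 * (n + 1) + n * (n + 1))"
    unfolding rho_def by (rule arg_cong[where f="\<lambda>k. 2 ^ k"]) (simp add: algebra_simps)
  also have "\<dots> = 4 ^ (n + 1) * rho n"
    unfolding power_add power_mult rho_def by simp
  finally show ?thesis by simp
qed

lemma lam_eq: "lam n = 8 * 4 ^ n"
  by (simp add: lam_def power_add power_mult)

lemma lam_rho: "lam n * rho n = 2 * rho (Suc n)"
  by (simp add: lam_eq rho_Suc)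

lemma lam_rho_Suc: "2 * lam n * rho (Suc n) = rho (Suc (Suc n))"
  by (simp add: lam_eq rho_Suc)

lemma rho_mono: "m \<le> n \<Longrightarrow> rho m \<le> rho n"
  unfolding rho_def by (intro power_increasing mult_le_mono) auto

lemma rho_0 [simp]: "rho 0 = 1"
  by (simp add: rho_def)

lemma rho_Suc_ge: "4 * rho n \<le> rho (Suc n)"
  unfolding rho_Suc using rho_pos[of n] by simp

text \<open>In exponents of 2 this is n^2 + 6 n + 11 \<le> (n + 4)^2.\<close>

lemma rho_over_expo: "4 * rho (Suc (Suc n)) / 2 ^ expo n \<le> 1 / 2 ^ (n + 3)"
proof -
  have r: "rho (Suc (Suc n)) = 2 ^ ((n + 2) * (n + 3))"
    unfolding rho_def by (rule arg_cong[where f="\<lambda>k. 2 ^ k"]) (simp add: algebra_simps)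
  have "4 * rho (Suc (Suc n)) * 2 ^ (n + 3) = 2 ^ (2 + (n + 2) * (n + 3) + (n + 3))"
    unfolding r power_add by simp
  also have "\<dots> \<le> 2 ^ expo n"
    by (rule power_increasing) (simp_all add: expo_def power2_eq_square algebra_simps)
  finally show ?thesis by (simp add: field_simps)
qed

lemma expo_ge: "16 \<le> expo n"
proof -
  have "4\<^sup>2 \<le> expo n" unfolding expo_def by (rule power_mono) auto
  thus ?thesis by simp
qed

lemma two_expo_ge: "(16::real) \<le> 2 ^ expo n"
proof -
  have "(2::real) ^ 4 \<le> 2 ^ expo n"
    using expo_ge[of n] by (intro power_increasing) auto
  thus ?thesis by simp
qed

section \<open>Bounds for one term inside, outside and within its annulus\<close>

text \<open>Here \<alpha>^N dominates the denominator: |z| \<le> \<alpha>/2 and |z| \<le> \<beta>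
  make the other two summands at most \<alpha>^N / 16 each.\<close>

lemma trm_small:
  assumes "cmod z \<le> rho n"
  shows "den n z \<noteq> 0" and "cmod (trm n z) \<le> 1 / 2 ^ (n + 3)"
proof -
  define x N \<alpha> \<beta> where "x = cmod z" and "N = expo n" and "\<alpha> = 2 * rho n" and "\<beta> = rho (Suc n) / 2"
  have x: "0 \<le> x" "x \<le> \<alpha> / 2" "x \<le> \<beta>"
    using assms rho_Suc_ge[of n] rho_pos[of n] by (auto simp: x_def \<alpha>_def \<beta>_def)
  have pos: "0 < \<alpha>" "0 < \<beta>"
    using rho_pos[of n] rho_pos[of "Suc n"] by (auto simp: \<alpha>_def \<beta>_def)
  have xN: "x ^ N \<le> \<alpha> ^ N / 2 ^ N"
    using power_mono[OF x(2) x(1), of N] by (simp add: power_divide)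
  have N: "(16::real) \<le> 2 ^ N" unfolding N_def by (rule two_expo_ge)
  have "\<alpha> ^ N / 2 ^ N \<le> \<alpha> ^ N / 16"
    using N pos by (intro divide_left_mono) auto
  hence x16: "x ^ N \<le> \<alpha> ^ N / 16" using xN by linarith
  have "(x / \<beta>) ^ N \<le> 1" using x pos by (intro power_le_one) auto
  hence xx: "(x / \<beta>) ^ N * x ^ N \<le> x ^ N"
    using x by (intro mult_left_le_one_le) auto
  have "cmod (of_real \<alpha> ^ N) \<le> cmod (den n z) + cmod (z ^ N + (z / of_real \<beta>) ^ N * z ^ N)"
    using norm_triangle_ineq4[of "den n z" "z ^ N + (z / of_real \<beta>) ^ N * z ^ N"]
    by (simp add: den_def N_def \<alpha>_def \<beta>_def)
  also have "cmod (z ^ N + (z / of_real \<beta>) ^ N * z ^ N) \<le> x ^ N + (x / \<beta>) ^ N * x ^ N"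
    using norm_triangle_ineq[of "z ^ N" "(z / of_real \<beta>) ^ N * z ^ N"] pos
    by (simp add: norm_mult norm_power norm_divide x_def)
  finally have "\<alpha> ^ N - 2 * x ^ N \<le> cmod (den n z)"
    using xx pos by (simp add: norm_power)
  hence den: "\<alpha> ^ N / 2 \<le> cmod (den n z)" using x16 pos zero_less_power[OF pos(1), of N] by linarith
  have aN: "0 < \<alpha> ^ N" using pos by simp
  show "den n z \<noteq> 0" using den aN by (metis half_gt_zero norm_zero not_less)
  have "cmod (trm n z) = lam n * (x * x ^ N) / cmod (den n z)"
    using lam_pos[of n] by (simp add: trm_def norm_mult norm_divide norm_power x_def N_def)
  also have "\<dots> \<le> lam n * (rho n * (\<alpha> ^ N / 2 ^ N)) / (\<alpha> ^ N / 2)"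
    using den pos lam_pos[of n] assms x xN rho_pos[of n] unfolding x_def[symmetric]
    by (intro frac_le mult_mono mult_nonneg_nonneg) auto
  also have "\<dots> = 4 * rho (Suc n) / 2 ^ N"
    using pos lam_rho[of n] by (simp add: field_simps)
  also have "\<dots> \<le> 4 * rho (Suc (Suc n)) / 2 ^ N"
    using rho_mono[of "Suc n" "Suc (Suc n)"] by (intro divide_right_mono) auto
  also have "\<dots> \<le> 1 / 2 ^ (n + 3)" unfolding N_def by (rule rho_over_expo)
  finally show "cmod (trm n z) \<le> 1 / 2 ^ (n + 3)" .
qed

text \<open>Now (z/\<beta>)^N z^N dominates the denominator, since |z| \<ge> 2 \<beta> makes it at
  least 2^N times as large as z^N, while \<alpha> \<le> |z|.\<close>

lemma trm_large:
  assumes "rho (Suc n) \<le> cmod z"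
  shows "den n z \<noteq> 0" and "cmod (trm n z) \<le> 1 / 2 ^ (n + 3)"
proof -
  define x N \<alpha> \<beta> where "x = cmod z" and "N = expo n" and "\<alpha> = 2 * rho n" and "\<beta> = rho (Suc n) / 2"
  have pos: "0 < \<alpha>" "0 < \<beta>"
    using rho_pos[of n] rho_pos[of "Suc n"] by (auto simp: \<alpha>_def \<beta>_def)
  have x: "2 * \<beta> \<le> x" "\<alpha> \<le> x" 
    using assms rho_Suc_ge[of n] rho_pos[of n] by (auto simp: x_def \<alpha>_def \<beta>_def)
  hence x0: "0 < x" using pos by linarith
  have N: "(16::real) \<le> 2 ^ N" unfolding N_def by (rule two_expo_ge)
  \<comment> \<open>One factor |z|/\<beta> is spent on cancelling the growth of
    \<open>lam n * z\<close>, so N - 1 of them remain.\<close>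
  obtain M where M: "N = Suc M" using expo_ge[of n] by (cases N) (auto simp: N_def)
  have "2 ^ N \<le> (x / \<beta>) ^ N" using x pos by (intro power_mono) (auto simp: field_simps)
  hence q16: "16 \<le> (x / \<beta>) ^ N" using N by linarith
  have aN: "\<alpha> ^ N \<le> x ^ N" using x pos by (intro power_mono) auto
  have "cmod ((z / of_real \<beta>) ^ N * z ^ N) \<le> cmod (den n z) + cmod (z ^ N + of_real \<alpha> ^ N)"
    using norm_triangle_ineq4[of "den n z" "z ^ N + of_real \<alpha> ^ N"]
    by (simp add: den_def N_def \<alpha>_def \<beta>_def algebra_simps)
  also have "cmod (z ^ N + of_real \<alpha> ^ N) \<le> x ^ N + \<alpha> ^ N"
    using norm_triangle_ineq[of "z ^ N" "of_real \<alpha> ^ N"] pos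
    by (simp add: norm_power x_def)
  finally have d: "(x / \<beta>) ^ N * x ^ N - 2 * x ^ N \<le> cmod (den n z)"
    using aN pos by (simp add: norm_power norm_mult norm_divide x_def)
  have "16 * x ^ N \<le> (x / \<beta>) ^ N * x ^ N"
    using q16 x0 by (intro mult_right_mono) auto
  hence den: "(x / \<beta>) ^ N * x ^ N / 2 \<le> cmod (den n z)"
    using d zero_less_power[OF x0, of N] by linarith
  have qpos: "0 < (x / \<beta>) ^ N * x ^ N / 2" using x0 pos by simp
  show "den n z \<noteq> 0" using den qpos by auto
  have "cmod (trm n z) = lam n * (x * x ^ N) / cmod (den n z)"
    using lam_pos[of n] by (simp add: trm_def norm_mult norm_divide norm_power x_def N_def)
  also have "\<dots> \<le> lam n * (x * x ^ N) / ((x / \<beta>) ^ N * x ^ N / 2)"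
    using den qpos lam_pos[of n] x0 by (intro frac_le) auto
  also have "\<dots> = 2 * lam n * \<beta> / (x / \<beta>) ^ M"
    using x0 pos by (simp add: M field_simps)
  also have "\<dots> \<le> 2 * lam n * \<beta> / 2 ^ M"
    using x pos lam_pos[of n]
    by (intro divide_left_mono power_mono) (auto simp: field_simps)
  also have "\<dots> = 4 * lam n * \<beta> / 2 ^ N" by (simp add: M)
  also have "\<dots> = rho (Suc (Suc n)) / 2 ^ N"
    using lam_rho_Suc[of n] by (simp add: \<beta>_def)
  also have "\<dots> \<le> 4 * rho (Suc (Suc n)) / 2 ^ N"
    using rho_pos[of "Suc (Suc n)"] by (intro divide_right_mono) auto
  also have "\<dots> \<le> 1 / 2 ^ (n + 3)" unfolding N_def by (rule rho_over_expo)
  finally show "cmod (trm n z) \<le> 1 / 2 ^ (n + 3)" .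
qed

text \<open>Since |z| is at least 2 \<alpha> and at most \<beta>/2, both corrections (z/\<beta>)^N
  and (\<alpha>/z)^N have modulus at most 2^-N.\<close>

lemma trm_middle:
  assumes "4 * rho n < cmod z" "cmod z < rho (Suc n) / 4"
  shows "den n z \<noteq> 0" and "cmod (trm n z - of_real (lam n) * z) \<le> lam n * cmod z / 2 ^ (n + 3)"
proof -
  define x N \<alpha> \<beta> where "x = cmod z" and "N = expo n" and "\<alpha> = 2 * rho n" and "\<beta> = rho (Suc n) / 2"
  define s where "s = (z / of_real \<beta>) ^ N + (of_real \<alpha> / z) ^ N"
  have pos: "0 < \<alpha>" "0 < \<beta>"
    using rho_pos[of n] rho_pos[of "Suc n"] by (auto simp: \<alpha>_def \<beta>_def)
  have x: "2 * \<alpha> \<le> x" "x \<le> \<beta> / 2" 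
    using assms by (auto simp: x_def \<alpha>_def \<beta>_def)
  hence x0: "0 < x" using pos by linarith
  hence z0: "z \<noteq> 0" by (auto simp: x_def)
  have N: "(16::real) \<le> 2 ^ N" unfolding N_def by (rule two_expo_ge)
  have "(x / \<beta>) ^ N \<le> (1/2) ^ N" using x x0 pos by (intro power_mono) (auto simp: field_simps)
  moreover have "(\<alpha> / x) ^ N \<le> (1/2) ^ N" using x x0 pos by (intro power_mono) (auto simp: field_simps)
  moreover have "cmod s \<le> (x / \<beta>) ^ N + (\<alpha> / x) ^ N"
    unfolding s_def using norm_triangle_ineq[of "(z / of_real \<beta>) ^ N" "(of_real \<alpha> / z) ^ N"] pos
    by (simp add: norm_power norm_divide x_def)
  ultimately have s: "cmod s \<le> 2 / 2 ^ N" by (simp add: power_divide)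
  also have "\<dots> \<le> 2 / 16" using N by (intro divide_left_mono) auto
  finally have s1: "cmod s \<le> 1 / 8" by simp
  have "1 \<le> cmod (1 + s) + cmod s" using norm_triangle_ineq4[of "1 + s" s] by simp
  hence s2: "1 / 2 \<le> cmod (1 + s)" using s1 by linarith
  hence s0: "1 + s \<noteq> 0" by auto
  have den: "den n z = z ^ N * (1 + s)"
    using z0 by (simp add: den_def s_def N_def \<alpha>_def \<beta>_def power_divide field_simps)
  show "den n z \<noteq> 0" using den s0 z0 by simp
  have trm: "trm n z = of_real (lam n) * z / (1 + s)"
    using z0 unfolding trm_def den by (simp add: N_def)
  have "trm n z - of_real (lam n) * z = - (of_real (lam n) * z * s / (1 + s))"
    using s0 unfolding trm by (simp add: field_simps)
  hence "cmod (trm n z - of_real (lam n) * z) = lam n * x * (cmod s / cmod (1 + s))"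
    using lam_pos[of n] by (simp add: norm_mult norm_divide x_def)
  also have "\<dots> \<le> lam n * x * ((2 / 2 ^ N) / (1/2))"
    using s s2 lam_pos[of n] x0 by (intro mult_left_mono frac_le) auto
  also have "\<dots> = lam n * x * (4 / 2 ^ N)" by simp
  also have "\<dots> \<le> lam n * x * (1 / 2 ^ (n + 3))"
  proof (rule mult_left_mono)
    have "4 * 1 / 2 ^ N \<le> 4 * rho (Suc (Suc n)) / 2 ^ N"
      using rho_mono[of 0 "Suc (Suc n)"] by (intro divide_right_mono mult_left_mono) auto
    thus "4 / 2 ^ N \<le> 1 / (2::real) ^ (n + 3)" using rho_over_expo[of n] by (simp add: N_def)
  qed (use lam_pos[of n] x0 in auto)
  finally show "cmod (trm n z - of_real (lam n) * z) \<le> lam n * cmod z / 2 ^ (n + 3)"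
    by (simp add: x_def)
qed

section \<open>The series and the meromorphic map it defines\<close>

definition trm_sum :: "complex \<Rightarrow> complex" where
  "trm_sum z = (\<Sum>n. trm n z)"

text \<open>At a pole of one term, division by zero gives that term the value 0 while the others
  still contribute; \<open>remove_sings\<close> restores the dummy value 0 of a nicely meromorphic
  function.\<close>

definition annular_map :: "complex \<Rightarrow> complex" where
  "annular_map = remove_sings trm_sum"

lemma summable_geom: "summable (\<lambda>n. 1 / (2::real) ^ (n + k))"
  and suminf_geom: "(\<Sum>n. 1 / (2::real) ^ (n + k)) = 2 / 2 ^ k"
proof -
  have "(\<lambda>n. (1 / 2 ^ k) * (1 / 2) ^ n) sums ((1 / 2 ^ k) * (1 / (1 - 1 / (2::real))))"
    by (intro sums_mult geometric_sums) auto
  hence "(\<lambda>n. 1 / (2::real) ^ (n + k)) sums (2 / 2 ^ k)"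
    by (simp add: power_divide power_add mult.commute)
  thus "summable (\<lambda>n. 1 / (2::real) ^ (n + k))" "(\<Sum>n. 1 / (2::real) ^ (n + k)) = 2 / 2 ^ k"
    by (simp_all add: sums_iff)
qed

lemma den_holomorphic [holomorphic_intros]: "den n holomorphic_on S"
  unfolding den_def by (intro holomorphic_intros) (use rho_pos[of "n+1"] in auto)

lemma trm_analytic: "den n z \<noteq> 0 \<Longrightarrow> trm n analytic_on {z}"
  unfolding trm_def
  by (intro analytic_intros) (auto intro: holomorphic_on_imp_analytic_at den_holomorphic)

lemma trm_meromorphic: "trm n meromorphic_on S"
proof -
  have "den n meromorphic_on S"
    by (rule meromorphic_on_subset[of _ UNIV], rule analytic_on_imp_meromorphic_on)
      (auto simp: analytic_on_open den_holomorphic)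
  thus ?thesis unfolding trm_def by (intro meromorphic_intros)
qed

text \<open>Terms of index at least m are small up to the circle of radius \<open>rho m\<close>. So
  on each disc the series is a finite sum of rational functions plus a holomorphic one.\<close>

lemma tail_holomorphic: "(\<lambda>z. \<Sum>n. trm (n + m) z) holomorphic_on ball 0 (rho m)"
proof (rule holomorphic_uniform_sequence[OF open_ball])
  fix k
  show "(\<lambda>z. \<Sum>n<k. trm (n + m) z) holomorphic_on ball 0 (rho m)"
  proof (intro holomorphic_on_sum)
    fix i
    have "den (i + m) z \<noteq> 0" if "z \<in> ball 0 (rho m)" for z
      using that rho_mono[of m "i + m"] by (intro trm_small) auto
    thus "trm (i + m) holomorphic_on ball 0 (rho m)"
      unfolding trm_def by (intro holomorphic_intros) auto
  qed
next
  fix z assume "z \<in> ball (0::complex) (rho m)"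
  then obtain d where d: "d > 0" "cball z d \<subseteq> ball 0 (rho m)"
    using open_contains_cball open_ball by blast
  have "uniform_limit (ball 0 (rho m)) (\<lambda>k z. \<Sum>n<k. trm (n + m) z) (\<lambda>z. \<Sum>n. trm (n + m) z) sequentially"
  proof (rule Weierstrass_m_test)
    fix n z assume z: "z \<in> ball (0::complex) (rho m)"
    hence "cmod (trm (n + m) z) \<le> 1 / 2 ^ (n + m + 3)"
      using rho_mono[of m "n + m"] by (intro trm_small) auto
    also have "\<dots> \<le> 1 / 2 ^ (n + 3)"
      by (intro divide_left_mono power_increasing) auto
    finally show "cmod (trm (n + m) z) \<le> 1 / 2 ^ (n + 3)" .
  qed (rule summable_geom)
  thus "\<exists>d>0. cball z d \<subseteq> ball 0 (rho m) \<and>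
      uniform_limit (cball z d) (\<lambda>k z. \<Sum>n<k. trm (n + m) z) (\<lambda>z. \<Sum>n. trm (n + m) z) sequentially"
    using d by (blast intro: uniform_limit_on_subset)
qed

lemma rho_ge: "real n \<le> rho n"
proof -
  have "real n \<le> 2 ^ n" using of_nat_less_two_power[of n, where 'a=real] by simp
  also have "\<dots> \<le> rho n" unfolding rho_def by (intro power_increasing) auto
  finally show ?thesis .
qed

lemma ex_rho_gt: "\<exists>n. x < rho n"
  using rho_ge reals_Archimedean2[of x] by (meson less_le_trans)

lemma trm_summable: "summable (\<lambda>n. trm n z)"
proof -
  obtain m where m: "cmod z < rho m" using ex_rho_gt by blast
  have "summable (\<lambda>n. trm (n + m) z)"
  proof (rule summable_comparison_test'[OF summable_geom[of 3]])
    fix n 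
    have "cmod (trm (n + m) z) \<le> 1 / 2 ^ (n + m + 3)"
      using m rho_mono[of m "n + m"] by (intro trm_small) auto
    also have "\<dots> \<le> 1 / 2 ^ (n + 3)"
      by (intro divide_left_mono power_increasing) auto
    finally show "cmod (trm (n + m) z) \<le> 1 / 2 ^ (n + 3)" .
  qed
  thus ?thesis using summable_iff_shift[of "\<lambda>n. trm n z" m] by simp
qed

lemma trm_sum_split: "trm_sum z = (\<Sum>n<m. trm n z) + (\<Sum>n. trm (n + m) z)"
  unfolding trm_sum_def using suminf_split_initial_segment[OF trm_summable, of z m] by simp

lemma trm_sum_meromorphic: "trm_sum meromorphic_on UNIV"
proof (subst meromorphic_on_meromorphic_at, safe)
  fix z
  obtain m where m: "cmod z < rho m" using ex_rho_gt by blast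
  have "(\<lambda>z. \<Sum>n. trm (n + m) z) meromorphic_on {z}"
    using tail_holomorphic[of m] m
    by (intro analytic_on_imp_meromorphic_on holomorphic_on_imp_analytic_at[OF _ open_ball]) auto
  moreover have "(\<lambda>z. \<Sum>n<m. trm n z) meromorphic_on {z}"
    by (rule meromorphic_on_sum) (rule trm_meromorphic)
  ultimately have "(\<lambda>z. (\<Sum>n<m. trm n z) + (\<Sum>n. trm (n + m) z)) meromorphic_on {z}"
    by (intro meromorphic_on_add)
  thus "trm_sum meromorphic_on {z}"
    unfolding trm_sum_split[of _ m, abs_def] .
qed

lemma trm_sum_analytic:
  assumes "\<And>n. den n z \<noteq> 0"
  shows "trm_sum analytic_on {z}"
proof -
  obtain m where m: "cmod z < rho m" using ex_rho_gt by blast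
  have "(\<lambda>z. \<Sum>n. trm (n + m) z) analytic_on {z}"
    using tail_holomorphic[of m] m
    by (intro holomorphic_on_imp_analytic_at[OF _ open_ball]) auto
  hence "(\<lambda>z. (\<Sum>n<m. trm n z) + (\<Sum>n. trm (n + m) z)) analytic_on {z}"
    by (intro analytic_intros trm_analytic assms)
  thus ?thesis by (simp add: trm_sum_split[of _ m, abs_def])
qed

lemma annular_map_nicely_meromorphic: "annular_map nicely_meromorphic_on UNIV"
  unfolding annular_map_def using trm_sum_meromorphic by (rule remove_sings_nicely_meromorphic)

lemma annular_map_eq:
  assumes "\<And>n. den n z \<noteq> 0"
  shows "annular_map z = trm_sum z" and "\<not> is_pole annular_map z"
proof -
  have an: "trm_sum analytic_on {z}" using assms by (rule trm_sum_analytic)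
  thus "annular_map z = trm_sum z" unfolding annular_map_def by simp
  have "annular_map analytic_on {z}" 
    unfolding annular_map_def using an by (rule remove_sings_analytic_on)
  thus "\<not> is_pole annular_map z" by (rule analytic_at_imp_no_pole)
qed

text \<open>Outside all open shells every term is small, and the bounds 2^-(n+3) sum to 1/4. This
  covers the unit disc and the separating circles.\<close>

lemma annular_map_small:
  assumes "\<And>n. cmod z \<le> rho n \<or> rho (Suc n) \<le> cmod z"
  shows "\<not> is_pole annular_map z" and "cmod (annular_map z) \<le> 1 / 4"
proof -
  have d: "den n z \<noteq> 0" for n using assms[of n] trm_small(1) trm_large(1) by blast
  have b: "cmod (trm n z) \<le> 1 / 2 ^ (n + 3)" for n using assms[of n] trm_small(2) trm_large(2) by blast
  show "\<not> is_pole annular_map z" using annular_map_eq(2) d by blast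
  have "cmod (trm_sum z) \<le> (\<Sum>n. 1 / 2 ^ (n + 3))"
    unfolding trm_sum_def using b summable_geom by (rule norm_suminf_le)
  thus "cmod (annular_map z) \<le> 1 / 4" using annular_map_eq(1)[OF d] by (simp add: suminf_geom)
qed

lemma annular_map_disc:
  assumes "cmod z \<le> 1"
  shows "\<not> is_pole annular_map z" and "cmod (annular_map z) \<le> 1 / 4"
proof -
  have "cmod z \<le> rho n \<or> rho (Suc n) \<le> cmod z" for n
    using assms rho_mono[of 0 n] by simp
  thus "\<not> is_pole annular_map z" "cmod (annular_map z) \<le> 1 / 4"
    using annular_map_small by blast+
qed

lemma annular_map_circle:
  assumes "cmod z = rho k"
  shows "\<not> is_pole annular_map z" and "cmod (annular_map z) \<le> 1 / 4"
proof -
  have "cmod z \<le> rho n \<or> rho (Suc n) \<le> cmod z" for n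
    using assms rho_mono[of k n] rho_mono[of "Suc n" k] by (cases "k \<le> n") auto
  thus "\<not> is_pole annular_map z" "cmod (annular_map z) \<le> 1 / 4"
    using annular_map_small by blast+
qed

lemma annular_map_middle:
  assumes "z \<in> annulus (4 * rho n) (rho (Suc n) / 4)"
  shows "\<not> is_pole annular_map z"
    and "cmod (annular_map z - of_real (lam n) * z) \<le> lam n * cmod z / 2 ^ (n + 2)"
proof -
  have z: "4 * rho n < cmod z" "cmod z < rho (Suc n) / 4" using assms by (auto simp: annulus_def)
  have out: "cmod z \<le> rho k \<or> rho (Suc k) \<le> cmod z" if "k \<noteq> n" for k
    using z rho_mono[of "Suc n" k] rho_mono[of "Suc k" n] rho_pos[of n] rho_pos[of "Suc n"] that 
    by (cases "k < n") auto
  have d: "den k z \<noteq> 0" for k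
    using out[of k] trm_small(1) trm_large(1) trm_middle(1)[OF z] by blast
  have b: "cmod (trm k z) \<le> 1 / 2 ^ (k + 3)" if "k \<noteq> n" for k 
    using out[OF that] trm_small(2) trm_large(2) by blast
  show "\<not> is_pole annular_map z" using annular_map_eq(2) d by blast
  define u where "u k = (if k = n then 0 else trm k z)" for k
  have u: "cmod (u k) \<le> 1 / 2 ^ (k + 3)" for k using b by (auto simp: u_def)
  have su: "summable u" using u by (intro summable_comparison_test'[OF summable_geom[of 3]]) auto
  have "(\<Sum>k. trm k z) = (\<Sum>k. (if k = n then trm n z else 0) + u k)"
    by (rule suminf_cong) (auto simp: u_def)
  also have "\<dots> = (\<Sum>k. if k = n then trm n z else 0) + (\<Sum>k. u k)"
    using su by (intro suminf_add[symmetric] summable_If_finite) auto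
  also have "(\<Sum>k. if k = n then trm n z else 0) = trm n z"
    using sums_If_finite[of "\<lambda>k. k = n" "\<lambda>_. trm n z"] sums_unique by fastforce
  finally have eq: "annular_map z = trm n z + (\<Sum>k. u k)"
    using annular_map_eq(1)[OF d] by (simp add: trm_sum_def)
  have "cmod (\<Sum>k. u k) \<le> (\<Sum>k. 1 / 2 ^ (k + 3))" using u summable_geom by (rule norm_suminf_le)
  hence "cmod (\<Sum>k. u k) \<le> 1 / 4" by (simp add: suminf_geom)
  \<comment> \<open>The other terms contribute a constant; as \<open>lam n\<close> is at least
    2^(n+3) and |z| at least 1, it is a relative error no larger than the one allowed for the n-th
    term.\<close>
  also have "1 / 4 \<le> lam n * cmod z / 2 ^ (n + 3)"
  proof -
    have "1 \<le> rho n" using rho_mono[of 0 n] by simp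
    hence "1 \<le> cmod z" using z by linarith
    moreover have "2 ^ (n + 3) \<le> lam n" unfolding lam_def by (intro power_increasing) auto
    ultimately have "1 * 2 ^ (n + 3) \<le> cmod z * lam n" by (intro mult_mono) auto
    hence "1 \<le> lam n * cmod z / 2 ^ (n + 3)" by (simp add: field_simps)
    thus ?thesis by linarith
  qed
  finally have "cmod (\<Sum>k. u k) \<le> lam n * cmod z / 2 ^ (n + 3)" .
  moreover have dec: "annular_map z - of_real (lam n) * z = (trm n z - of_real (lam n) * z) + (\<Sum>k. u k)"
    using eq by simp
  ultimately have "cmod (annular_map z - of_real (lam n) * z) \<le> 2 * (lam n * cmod z / 2 ^ (n + 3))"
    using trm_middle(2)[OF z] norm_triangle_ineq[of "trm n z - of_real (lam n) * z" "\<Sum>k. u k"]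
    unfolding dec by linarith
  thus "cmod (annular_map z - of_real (lam n) * z) \<le> lam n * cmod z / 2 ^ (n + 2)" by (simp add: field_simps power_add)
qed

lemma annular_map_ratio:
  assumes "z \<in> annulus (4 * rho n) (rho (Suc n) / 4)"
  shows "(1 - 1 / 2 ^ (n + 2)) * (lam n * cmod z) \<le> cmod (annular_map z)"
    and "cmod (annular_map z) \<le> (1 + 1 / 2 ^ (n + 2)) * (lam n * cmod z)"
proof -
  have b: "cmod (annular_map z - of_real (lam n) * z) \<le> lam n * cmod z / 2 ^ (n + 2)"
    by (rule annular_map_middle[OF assms])
  have l: "cmod (of_real (lam n) * z) = lam n * cmod z" 
    using lam_pos[of n] by (simp add: norm_mult)
  show "(1 - 1 / 2 ^ (n + 2)) * (lam n * cmod z) \<le> cmod (annular_map z)"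
    using b norm_triangle_ineq3[of "annular_map z" "of_real (lam n) * z"] l
    by (simp add: left_diff_distrib abs_le_iff)
  show "cmod (annular_map z) \<le> (1 + 1 / 2 ^ (n + 2)) * (lam n * cmod z)"
    using b norm_triangle_ineq3[of "annular_map z" "of_real (lam n) * z"] l
    by (simp add: distrib_right abs_le_iff)
qed

text \<open>The exact dilation lands between 8 \<open>rho (n + 1)\<close> and
  \<open>rho (n + 2)\<close> / 8; a relative error of at most 1/4 stays within the spare factor
  2.\<close>

lemma annular_map_annulus:
  assumes "z \<in> annulus (4 * rho n) (rho (Suc n) / 4)"
  shows "annular_map z \<in> annulus (4 * rho (Suc n)) (rho (Suc (Suc n)) / 4)"
proof -
  have z: "4 * rho n < cmod z" "cmod z < rho (Suc n) / 4" using assms by (auto simp: annulus_def)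
  have p: "1 / 2 ^ (n + 2) \<le> (1::real) / 4"
    using one_le_power[of "2::real" n] by (simp add: field_simps)
  have m: "0 < lam n * cmod z" using lam_pos[of n] z rho_pos[of n] by (intro mult_pos_pos) auto
  have "8 * rho (Suc n) = lam n * (4 * rho n)" using lam_rho[of n] by simp
  also have "\<dots> < lam n * cmod z" using z lam_pos[of n] by (intro mult_strict_left_mono) auto
  finally have lo: "8 * rho (Suc n) < lam n * cmod z" .
  have "lam n * cmod z < lam n * (rho (Suc n) / 4)"
    using z lam_pos[of n] by (intro mult_strict_left_mono) auto
  also have "\<dots> = rho (Suc (Suc n)) / 8" using lam_rho_Suc[of n] by simp
  finally have hi: "lam n * cmod z < rho (Suc (Suc n)) / 8" .
  have "(3 / 4) * (lam n * cmod z) \<le> (1 - 1 / 2 ^ (n + 2)) * (lam n * cmod z)"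
    using p m by (intro mult_right_mono) auto
  hence 1: "4 * rho (Suc n) < cmod (annular_map z)"
    using annular_map_ratio(1)[OF assms] lo rho_pos[of "Suc n"] by linarith
  have "(1 + 1 / 2 ^ (n + 2)) * (lam n * cmod z) \<le> (5 / 4) * (lam n * cmod z)"
    using p m by (intro mult_right_mono) auto
  hence 2: "cmod (annular_map z) < rho (Suc (Suc n)) / 4"
    using annular_map_ratio(2)[OF assms] hi rho_pos[of "Suc (Suc n)"] by linarith
  from 1 2 show ?thesis by (simp add: annulus_def)
qed

definition cent :: "nat \<Rightarrow> real" where "cent n = 2 ^ (n + 1) * rho n"

lemma cent_pos: "0 < cent n" by (simp add: cent_def rho_pos)

lemma rho_Suc_cent: "rho (Suc n) = 2 ^ (n + 1) * cent n"
proof -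
  have "(4::real) ^ n = 2 ^ n * 2 ^ n" by (simp flip: power_mult_distrib)
  thus ?thesis by (simp add: rho_Suc cent_def)
qed

lemma cent_Suc: "cent (Suc n) = lam n * cent n"
  by (simp add: cent_def lam_eq rho_Suc)

text \<open>For n < 2 the annulus is empty, as \<open>rho (n + 1)\<close> is at most 16
  \<open>rho n\<close>. This is why the components below are attached to the index n + 2.\<close>

lemma cent_in_annulus:
  assumes "2 \<le> n"
  shows "of_real (cent n) \<in> annulus (4 * rho n) (rho (Suc n) / 4)"
proof -
  have "(2::real) ^ 3 \<le> 2 ^ (n + 1)" using assms by (intro power_increasing) auto
  hence p: "4 < (2::real) ^ (n + 1)" by simp
  have "4 * rho n < cent n" unfolding cent_def using p rho_pos[of n] by (intro mult_strict_right_mono)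
  moreover have "4 * cent n < rho (Suc n)" 
    unfolding rho_Suc_cent using p cent_pos[of n] by (intro mult_strict_right_mono)
  ultimately show ?thesis using cent_pos[of n] by (simp add: annulus_def)
qed

section \<open>Transcendence\<close>

lemma poly_eventually_nonzero:
  fixes p :: "complex poly"
  assumes "p \<noteq> 0"
  shows "eventually (\<lambda>z. poly p z \<noteq> 0) at_infinity"
proof -
  obtain B where B: "\<And>z. poly p z = 0 \<Longrightarrow> norm z \<le> B"
    using finite_imp_bounded[OF poly_roots_finite[OF assms]] by (auto simp: bounded_iff)
  thus ?thesis
    by (intro eventually_at_infinityI[of "B + 1"]) fastforce
qed

lemma rational_bounded_or_infinite:
  fixes p q :: "complex poly"
  assumes "q \<noteq> 0"
  shows "filterlim (\<lambda>z. poly p z / poly q z) at_infinity at_infinity \<or>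
    (\<exists>c. ((\<lambda>z. poly p z / poly q z) \<longlongrightarrow> c) at_infinity)"
proof -
  consider "degree p < degree q" | "degree p = degree q" | "degree q < degree p" by linarith
  thus ?thesis
  proof cases
    case 1
    thus ?thesis using poly_divide_tendsto_0_at_infinity by blast
  next
    case 2
    have "((\<lambda>z. (poly p z / z ^ degree p) / (poly q z / z ^ degree q)) \<longlongrightarrow> lead_coeff p / lead_coeff q) at_infinity"
      using assms by (intro tendsto_divide poly_divide_tendsto_aux) auto
    moreover have "eventually (\<lambda>z. (poly p z / z ^ degree p) / (poly q z / z ^ degree q) = poly p z / poly q z) at_infinity"
      by (rule eventually_at_infinityI[of 1]) (use 2 in auto)
    ultimately have "((\<lambda>z. poly p z / poly q z) \<longlongrightarrow> lead_coeff p / lead_coeff q) at_infinity"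
      using tendsto_cong by fast
    thus ?thesis by blast
  next
    case 3
    hence "p \<noteq> 0" by auto
    have "((\<lambda>z. poly q z / poly p z) \<longlongrightarrow> 0) at_infinity"
      using 3 by (rule poly_divide_tendsto_0_at_infinity)
    moreover have "eventually (\<lambda>z. poly q z / poly p z \<noteq> 0) at_infinity"
      using poly_eventually_nonzero[OF assms] poly_eventually_nonzero[OF \<open>p \<noteq> 0\<close>]
      by eventually_elim auto
    ultimately have "filterlim (\<lambda>z. inverse (poly p z / poly q z)) (at 0) at_infinity"
      by (simp add: filterlim_at)
    thus ?thesis unfolding filterlim_inverse_at_iff by blast
  qed
qed

text \<open>A rational function has a finite or infinite limit at infinity; this map is bounded
  along the radii \<open>rho n\<close> and unbounded along \<open>cent n\<close>.\<close>

lemma annular_map_not_rational: "\<not> rational_function annular_map"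
proof
  assume "rational_function annular_map"
  then obtain p q where q: "q \<noteq> 0" and eq: "\<And>z. poly q z \<noteq> 0 \<Longrightarrow> annular_map z = poly p z / poly q z"
    unfolding rational_function_def by blast
  have ev: "eventually (\<lambda>z. poly p z / poly q z = annular_map z) at_infinity"
    using poly_eventually_nonzero[OF q] by eventually_elim (simp add: eq)
  have rho_inf: "filterlim (\<lambda>n. complex_of_real (rho n)) at_infinity sequentially"
    unfolding filterlim_at_infinity_conv_norm_at_top
    by (rule filterlim_at_top_mono[OF filterlim_real_sequentially]) (use rho_ge rho_pos in \<open>auto simp: less_imp_le\<close>)
  have cent_inf: "filterlim (\<lambda>n. complex_of_real (cent n)) at_infinity sequentially"
    unfolding filterlim_at_infinity_conv_norm_at_top
  proof (rule filterlim_at_top_mono[OF filterlim_real_sequentially], rule always_eventually, rule)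
    fix n
    have "1 * rho n \<le> cent n" unfolding cent_def using rho_pos[of n]
      by (intro mult_right_mono one_le_power) auto
    thus "real n \<le> cmod (complex_of_real (cent n))" using rho_ge[of n] cent_pos[of n] by simp
  qed
  have small: "cmod (annular_map (of_real (rho n))) \<le> 1 / 4" for n
    using rho_pos[of n] by (intro annular_map_circle[where k=n]) auto
  have large: "cmod (annular_map (of_real (cent n))) \<ge> rho n" if "2 \<le> n" for n
    using annular_map_annulus[OF cent_in_annulus[OF that]] rho_mono[of n "Suc n"] rho_pos[of "Suc n"]
    by (simp add: annulus_def)
  from rational_bounded_or_infinite[OF q, of p] show False
  proof
    assume "filterlim (\<lambda>z. poly p z / poly q z) at_infinity at_infinity"
    hence "filterlim annular_map at_infinity at_infinity"
      using filterlim_cong[OF refl refl ev] by simp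
    hence "filterlim (\<lambda>n. annular_map (of_real (rho n))) at_infinity sequentially"
      using rho_inf by (rule filterlim_compose)
    hence "eventually (\<lambda>n. 1 \<le> cmod (annular_map (of_real (rho n)))) sequentially"
      by (simp add: filterlim_at_infinity_conv_norm_at_top filterlim_at_top)
    then obtain n where "1 \<le> cmod (annular_map (of_real (rho n)))"
      using eventually_happens sequentially_bot by blast
    thus False using small[of n] by linarith
  next
    assume "\<exists>c. ((\<lambda>z. poly p z / poly q z) \<longlongrightarrow> c) at_infinity"
    then obtain c where "(annular_map \<longlongrightarrow> c) at_infinity"
      using filterlim_cong[OF refl refl ev] by auto
    hence "((\<lambda>n. annular_map (of_real (cent n))) \<longlonglongrightarrow> c)"
      using cent_inf by (rule filterlim_compose)
    hence "Bseq (\<lambda>n. annular_map (of_real (cent n)))" 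
      using convergentI convergent_imp_Bseq by blast
    then obtain K where K: "\<And>n. cmod (annular_map (of_real (cent n))) \<le> K"
      unfolding Bseq_def by blast
    obtain n where "K < rho n" using ex_rho_gt by blast
    moreover have "rho n \<le> rho (n + 2)" by (rule rho_mono) simp
    ultimately show False using K[of "n + 2"] large[of "n + 2"] by simp
  qed
qed

section \<open>The wandering domain\<close>

definition ann :: "nat \<Rightarrow> complex set" where
  "ann n = annulus (4 * rho n) (rho (Suc n) / 4)"

abbreviation esc :: "complex set" where
  "esc \<equiv> escaping_points annular_map"

definition ecomp :: "nat \<Rightarrow> complex set" where
  "ecomp n = connected_component_set esc (of_real (cent (n + 2)))"

lemma open_ann: "open (ann n)"
  unfolding ann_def annulus_def by (intro open_Collect_conj open_Collect_less continuous_intros)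

lemma connected_ann: "connected (ann n)"
  unfolding ann_def annulus_def
  using connected_annulus(1)[of "4 * rho n" "0::complex" "rho (Suc n) / 4"] by simp

lemma ann_orbit: "z \<in> ann n \<Longrightarrow> (annular_map ^^ k) z \<in> ann (n + k)"
  by (induction k) (auto simp: ann_def annular_map_annulus)

lemma ann_escaping: "ann n \<subseteq> esc"
proof -
  have "escapes_uniformly annular_map (ann n)"
    unfolding escapes_uniformly_def pole_free_orbit_def
  proof (intro conjI ballI allI)
    fix z k assume "z \<in> ann n"
    thus "\<not> is_pole annular_map ((annular_map ^^ k) z)"
      using annular_map_middle(1) ann_orbit unfolding ann_def by blast
  next
    fix B :: real
    have "B \<le> cmod ((annular_map ^^ k) z)" if "z \<in> ann n" "B \<le> real k" for k z
    proof -
      have "B \<le> real (n + k)" using that by simp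
      also have "\<dots> \<le> 4 * rho (n + k)" using rho_ge[of "n + k"] rho_pos[of "n + k"] by linarith
      also have "\<dots> \<le> cmod ((annular_map ^^ k) z)"
        using ann_orbit[OF that(1), of k] by (simp add: ann_def annulus_def)
      finally show ?thesis .
    qed
    moreover have "\<forall>\<^sub>F k in sequentially. B \<le> real k"
      using filterlim_real_sequentially by (simp add: filterlim_at_top)
    ultimately show "\<forall>\<^sub>F k in sequentially. \<forall>z\<in>ann n. B \<le> cmod ((annular_map ^^ k) z)"
      by (auto elim: eventually_mono)
  qed
  thus ?thesis using open_ann unfolding escaping_points_def by blast
qed

lemma circle_not_escaping:
  assumes "cmod z = rho k"
  shows "z \<notin> esc"
proof
  assume "z \<in> esc"
  have "cmod ((annular_map ^^ Suc n) z) \<le> 1 / 4" for n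
  proof (induction n)
    case 0
    show ?case using annular_map_circle(2)[OF assms] by simp
  next
    case (Suc n)
    hence "cmod (annular_map ((annular_map ^^ Suc n) z)) \<le> 1 / 4"
      by (intro annular_map_disc(2)) linarith
    thus ?case by simp
  qed
  note small = this
  obtain N where "\<And>n. n \<ge> N \<Longrightarrow> 1 \<le> cmod ((annular_map ^^ n) z)"
    using escaping_points_escape[OF \<open>z \<in> esc\<close>, of 1] unfolding eventually_sequentially by blast
  hence "1 \<le> cmod ((annular_map ^^ Suc N) z)" using le_SucI[OF order_refl] by blast
  also have "\<dots> \<le> 1 / 4" by (rule small)
  finally show False by simp
qed

lemma cent_in_ann: "of_real (cent (n + 2)) \<in> ann (n + 2)"
  unfolding ann_def by (intro cent_in_annulus) simp

lemma ecomp_component: "ecomp n \<in> components esc"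
  unfolding ecomp_def using cent_in_ann[of n] ann_escaping by (intro componentsI) auto

lemma ecomp_subset: "ecomp n \<subseteq> esc" and connected_ecomp: "connected (ecomp n)" and open_ecomp: "open (ecomp n)"
  using ecomp_component open_escaping_points
  by (auto dest: in_components_subset in_components_connected open_components)

lemma ann_subset_ecomp: "ann (n + 2) \<subseteq> ecomp n"
  unfolding ecomp_def using cent_in_ann ann_escaping connected_ann
  by (intro connected_component_maximal) auto

lemma cent_in_ecomp: "of_real (cent (n + 2)) \<in> ecomp n"
  using cent_in_ann ann_subset_ecomp by blast

text \<open>The moduli of a connected set form an interval; this one contains the centre and misses
  every \<open>rho k\<close>.\<close>

lemma ecomp_bounds:
  assumes "z \<in> ecomp n"
  shows "rho (n + 2) < cmod z" and "cmod z < rho (n + 3)"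
proof -
  have "connected (cmod ` ecomp n)"
    by (intro connected_continuous_image connected_ecomp continuous_intros)
  note Icc = connected_contains_Icc[OF this]
  have avoid: "rho k \<notin> cmod ` ecomp n" for k
    using circle_not_escaping ecomp_subset[of n] by (metis imageE subsetD)
  have "cmod (of_real (cent (n + 2))) \<in> cmod ` ecomp n" using cent_in_ecomp by (rule imageI)
  hence c: "cent (n + 2) \<in> cmod ` ecomp n" using cent_pos[of "n + 2"] by simp
  have "of_real (cent (n + 2)) \<in> ann (n + 2)" by (rule cent_in_ann)
  hence cb: "rho (n + 2) < cent (n + 2)" "cent (n + 2) < rho (n + 3)"
    using cent_pos[of "n + 2"] rho_pos[of "n + 2"] rho_pos[of "n + 3"]
    by (auto simp: ann_def annulus_def numeral_3_eq_3)
  have z: "cmod z \<in> cmod ` ecomp n" using assms by blast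
  show "rho (n + 2) < cmod z"
  proof (rule ccontr)
    assume "\<not> rho (n + 2) < cmod z"
    hence "rho (n + 2) \<in> {cmod z..cent (n + 2)}" using cb by simp
    thus False using Icc[OF z c] avoid by blast
  qed
  show "cmod z < rho (n + 3)"
  proof (rule ccontr)
    assume "\<not> cmod z < rho (n + 3)"
    hence "rho (n + 3) \<in> {cent (n + 2)..cmod z}" using cb by simp
    thus False using Icc[OF c z] avoid by blast
  qed
qed

lemma annular_map_holomorphic_ecomp: "(annular_map ^^ k) holomorphic_on ecomp n"
  using ecomp_subset escaping_points_pole_free
  by (intro funpow_holomorphic[OF annular_map_nicely_meromorphic]) blast

lemma ecomp_forward: "annular_map ` ecomp n \<subseteq> ecomp (Suc n)"
proof (rule components_maximal[OF ecomp_component])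
  show "connected (annular_map ` ecomp n)"
    using annular_map_holomorphic_ecomp[of 1 n]
    by (intro connected_continuous_image holomorphic_on_imp_continuous_on connected_ecomp) simp
  show "annular_map ` ecomp n \<subseteq> esc"
    using ecomp_subset escaping_points_forward[OF annular_map_nicely_meromorphic annular_map_not_rational]
    by blast
  have "annular_map (of_real (cent (n + 2))) \<in> ann (Suc n + 2)"
    using ann_orbit[OF cent_in_ann[of n], of 1] by simp
  thus "ecomp (Suc n) \<inter> annular_map ` ecomp n \<noteq> {}"
    using ann_subset_ecomp[of "Suc n"] cent_in_ecomp[of n] by blast
qed

lemma ecomp_closed: "esc \<inter> closure (ecomp n) \<subseteq> ecomp n"
  using closedin_component[OF ecomp_component, of n] unfolding closedin_Int_closure_of by simp

text \<open>A preimage sequence has a limit point, since the component is bounded. The limit point is not a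
  pole, since \<open>w\<close> is finite.\<close>

lemma limit_of_image_in_image:
  assumes w: "w \<in> closure (annular_map ` ecomp n)" "w \<in> esc"
  shows "w \<in> annular_map ` ecomp n"
proof -
  obtain y where y: "\<And>j::nat. y j \<in> annular_map ` ecomp n" "y \<longlonglongrightarrow> w"
    using w(1) unfolding closure_sequential by blast
  hence "\<forall>j. \<exists>z. z \<in> ecomp n \<and> y j = annular_map z" by blast
  then obtain \<zeta> where zeta: "\<And>j. \<zeta> j \<in> ecomp n" "\<And>j. y j = annular_map (\<zeta> j)" by metis
  have "\<zeta> j \<in> cball 0 (rho (n + 3))" for j
    using ecomp_bounds(2)[OF zeta(1)[of j]] by simp
  then obtain z \<sigma> where \<sigma>: "strict_mono (\<sigma>::nat \<Rightarrow> nat)" "(\<zeta> \<circ> \<sigma>) \<longlonglongrightarrow> z"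
    using compact_cball[of "0::complex" "rho (n + 3)"] unfolding compact_def by metis
  have lim: "(\<lambda>j. annular_map (\<zeta> (\<sigma> j))) \<longlonglongrightarrow> w"
    using LIMSEQ_subseq_LIMSEQ[OF y(2) \<sigma>(1)] zeta(2) by (simp add: o_def)
  have np: "\<not> is_pole annular_map z"
  proof
    assume pole: "is_pole annular_map z"
    have "\<not> is_pole annular_map (\<zeta> j)" for j
      using zeta(1)[of j] ecomp_subset escaping_points_pole_free[of "\<zeta> j" annular_map]
      unfolding pole_free_orbit_def by (metis funpow_0 subsetD)
    hence "\<zeta> (\<sigma> j) \<noteq> z" for j using pole by metis
    hence "filterlim (\<lambda>j. \<zeta> (\<sigma> j)) (at z) sequentially"
      using \<sigma>(2) by (simp add: filterlim_at o_def)
    hence "filterlim (\<lambda>j. annular_map (\<zeta> (\<sigma> j))) at_infinity sequentially"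
      using pole unfolding is_pole_def by (rule filterlim_compose[rotated])
    thus False using lim not_tendsto_and_filterlim_at_infinity[OF sequentially_bot] by blast
  qed
  hence "annular_map analytic_on {z}"
    using nicely_meromorphic_on_imp_analytic_at[OF annular_map_nicely_meromorphic] by simp
  hence "isCont annular_map z" by (rule analytic_at_imp_isCont)
  hence "(\<lambda>j. annular_map (\<zeta> (\<sigma> j))) \<longlonglongrightarrow> annular_map z"
    by (rule isCont_tendsto_compose) (use \<sigma>(2) in \<open>simp add: o_def\<close>)
  hence eq: "annular_map z = w" using lim by (rule LIMSEQ_unique)
  hence "z \<in> esc" using escaping_points_backward[OF annular_map_nicely_meromorphic np] w(2) by simp
  moreover have "z \<in> closure (ecomp n)"
    unfolding closure_sequential using \<sigma>(2) zeta(1) by (intro exI[of _ "\<zeta> \<circ> \<sigma>"]) auto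
  ultimately show ?thesis using eq ecomp_closed by blast
qed

text \<open>The image is open by the open mapping theorem and relatively closed by the preceding
  lemma, so it exhausts the connected target.\<close>

lemma ecomp_image: "annular_map ` ecomp n = ecomp (Suc n)"
proof -
  have "open (annular_map ` ecomp n)"
  proof (rule open_mapping_thm[OF _ open_ecomp connected_ecomp open_ecomp])
    show "annular_map holomorphic_on ecomp n" using annular_map_holomorphic_ecomp[of 1 n] by simp
    show "\<not> annular_map constant_on ecomp n"
      using open_ecomp cent_in_ecomp
      by (intro nonconstant_if_not_rational[OF annular_map_nicely_meromorphic annular_map_not_rational]) auto
  qed simp
  hence "openin (top_of_set (ecomp (Suc n))) (annular_map ` ecomp n)"
    using ecomp_forward by (simp add: open_subset)
  moreover have "closedin (top_of_set (ecomp (Suc n))) (annular_map ` ecomp n)"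
  proof -
    have "ecomp (Suc n) \<inter> closure (annular_map ` ecomp n) = annular_map ` ecomp n"
      using ecomp_forward closure_subset limit_of_image_in_image ecomp_subset by fastforce
    thus ?thesis unfolding closedin_Int_closure_of by simp
  qed
  moreover have "annular_map ` ecomp n \<noteq> {}" using cent_in_ecomp by blast
  ultimately show ?thesis using connected_ecomp[of "Suc n"] unfolding connected_clopen by blast
qed

lemma ecomp_funpow: "(annular_map ^^ n) ` ecomp 0 = ecomp n"
proof (induction n)
  case (Suc n)
  have "(annular_map ^^ Suc n) ` ecomp 0 = annular_map ` (annular_map ^^ n) ` ecomp 0"
    by (simp add: image_comp)
  thus ?case using Suc ecomp_image by simp
qed simp

section \<open>Growth of orbits relative to the centres\<close>

text \<open>From time N on, the modulus relative to the centre changes at step n by a factor between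
  1 - e_n and 1 + e_n, where e_n halves each time. Then (1 - 4 e_n) w_n is nondecreasing and (1 + 4
  e_n) w_n nonincreasing, which takes the place of an infinite product.\<close>

lemma orbit_growth:
  assumes "(annular_map ^^ N) z \<in> ann (N + 2)"
  shows "\<exists>c C. 0 < c \<and> 0 < C \<and> (\<forall>\<^sub>F n in sequentially.
    c * cent (n + 2) \<le> cmod ((annular_map ^^ n) z) \<and> cmod ((annular_map ^^ n) z) \<le> C * cent (n + 2))"
proof -
  define w where "w n = cmod ((annular_map ^^ n) z) / cent (n + 2)" for n
  \<comment> \<open>At time n the orbit is in the annulus of index n + 2, so the error 2^-(k+2) of
    \<open>annular_map_ratio\<close> is taken at k = n + 2.\<close>
  define e where "e n = 1 / (2::real) ^ (n + 4)" for n
  have e_eq: "e n = 1 / (16 * 2 ^ n)" for n unfolding e_def power_add by simp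
  have e: "0 < e n" "e n \<le> 1 / 16" "e (Suc n) = e n / 2" for n
    using one_le_power[of "2::real" n] by (simp_all add: e_eq field_simps)
  have e4: "2 * e n = 4 * e (Suc n)" for n using e(3)[of n] by simp
  have orb: "(annular_map ^^ n) z \<in> ann (n + 2)" if "N \<le> n" for n
  proof -
    have "(annular_map ^^ (n - N)) ((annular_map ^^ N) z) \<in> ann (N + 2 + (n - N))"
      by (rule ann_orbit[OF assms])
    thus ?thesis using that by (simp flip: funpow_add[unfolded o_def, THEN fun_cong])
  qed
  have w0: "0 \<le> w n" for n using cent_pos[of "n + 2"] by (simp add: w_def)
  have ratio: "(1 - e n) * w n \<le> w (Suc n)" "w (Suc n) \<le> (1 + e n) * w n" if "N \<le> n" for n
  proof -
    note r = annular_map_ratio[OF orb[OF that, unfolded ann_def]]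
    have "cent (Suc n + 2) = lam (n + 2) * cent (n + 2)" using cent_Suc[of "n + 2"] by simp
    hence eq: "w (Suc n) = cmod (annular_map ((annular_map ^^ n) z)) / (lam (n + 2) * cent (n + 2))"
      by (simp add: w_def)
    have p: "0 < lam (n + 2) * cent (n + 2)" using lam_pos cent_pos by simp
    have w: "w n = lam (n + 2) * cmod ((annular_map ^^ n) z) / (lam (n + 2) * cent (n + 2))"
      using lam_pos[of "n + 2"] by (simp add: w_def)
    have e': "e n = 1 / 2 ^ (n + 2 + 2)" by (simp add: e_eq power_add)
    show "(1 - e n) * w n \<le> w (Suc n)" "w (Suc n) \<le> (1 + e n) * w n"
      unfolding eq w e' using r p by (simp_all only: times_divide_eq_right divide_right_mono less_imp_le)
  qed
  have lo: "(1 - 4 * e N) * w N \<le> (1 - 4 * e n) * w n" if "N \<le> n" for n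
    using that
  proof (induction n rule: dec_induct)
    case (step n)
    have "(1 - 4 * e n) * w n \<le> (1 - 2 * e n) * (1 - e n) * w n"
      using w0[of n] e(1)[of n]
      by (intro mult_right_mono)
        (auto simp: algebra_simps intro!: add_nonneg_nonneg mult_nonneg_nonneg)
    also have "\<dots> \<le> (1 - 2 * e n) * w (Suc n)"
      unfolding mult.assoc using \<open>N \<le> n\<close> assms e(2)[of n]
      by (intro mult_left_mono) (auto intro: ratio(1))
    finally show ?case using step.IH unfolding e4 by linarith
  qed simp
  have hi: "(1 + 4 * e n) * w n \<le> (1 + 4 * e N) * w N" if "N \<le> n" for n
    using that
  proof (induction n rule: dec_induct)
    case (step n)
    have "(1 + 2 * e n) * w (Suc n) \<le> (1 + 2 * e n) * (1 + e n) * w n"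
      unfolding mult.assoc using \<open>N \<le> n\<close> e(1)[of n]
      by (intro mult_left_mono) (auto intro: ratio(2))
    also have "\<dots> \<le> (1 + 4 * e n) * w n"
    proof (rule mult_right_mono)
      have "e n * e n \<le> e n * (1 / 16)" using e(1)[of n] e(2)[of n] by (intro mult_left_mono) auto
      thus "(1 + 2 * e n) * (1 + e n) \<le> 1 + 4 * e n" using e(1)[of n] by (simp add: algebra_simps)
    qed (rule w0)
    finally show ?case using step.IH unfolding e4 by linarith
  qed simp
  have wN: "0 < w N"
    using assms rho_pos[of "N + 2"] cent_pos[of "N + 2"]
    by (auto simp: w_def ann_def annulus_def intro!: divide_pos_pos)
  have "\<forall>\<^sub>F n in sequentially. N \<le> n" by (rule eventually_ge_at_top)
  hence "\<forall>\<^sub>F n in sequentially. (w N / 2) * cent (n + 2) \<le> cmod ((annular_map ^^ n) z) \<and>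
    cmod ((annular_map ^^ n) z) \<le> (2 * w N) * cent (n + 2)"
  proof eventually_elim
    case (elim n)
    have "w N / 2 \<le> (1 - 4 * e N) * w N"
      using mult_right_mono[of "1/2" "1 - 4 * e N" "w N"] e(2)[of N] w0[of N] by simp
    also have "\<dots> \<le> (1 - 4 * e n) * w n" by (rule lo[OF elim])
    also have "\<dots> \<le> w n" using e(1)[of n] w0[of n] by (intro mult_left_le_one_le) (use e(2)[of n] in auto)
    finally have 1: "w N / 2 \<le> w n" .
    have "w n \<le> (1 + 4 * e n) * w n" using e(1)[of n] w0[of n] by (simp add: distrib_right)
    also have "\<dots> \<le> (1 + 4 * e N) * w N" by (rule hi[OF elim])
    also have "\<dots> \<le> 2 * w N" using e(2)[of N] w0[of N] by (intro mult_right_mono) auto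
    finally have 2: "w n \<le> 2 * w N" .
    from 1 2 show ?case using cent_pos[of "n + 2"] by (simp add: w_def field_simps)
  qed
  moreover have "0 < w N / 2" "0 < 2 * w N" using wN by auto
  ultimately show ?thesis by blast
qed

text \<open>On either side the ratio between \<open>cent (n + 2)\<close> and the radius of the
  bounding circle is 2^(n+3), which beats any constant, in particular the cubes lost to
  Harnack.\<close>

lemma eventually_cent_quotient: "\<forall>\<^sub>F n in sequentially. x * cent (n + 2) \<le> rho (n + 3)"
  and eventually_rho_quotient: "0 < c \<Longrightarrow> \<forall>\<^sub>F n in sequentially. y * rho (n + 2) \<le> c * cent (n + 2)"
proof -
  have pow: "\<forall>\<^sub>F n in sequentially. x \<le> 2 ^ (n + 3)" for x :: real
  proof -
    have "\<forall>\<^sub>F n in sequentially. x \<le> real n"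
      using filterlim_real_sequentially by (simp add: filterlim_at_top)
    thus ?thesis
    proof eventually_elim
      case (elim n)
      have "real n \<le> 2 ^ n" using of_nat_less_two_power[of n, where 'a=real] by simp
      also have "\<dots> \<le> 2 ^ (n + 3)" by (intro power_increasing) auto
      finally show ?case using elim by linarith
    qed
  qed
  show "\<forall>\<^sub>F n in sequentially. x * cent (n + 2) \<le> rho (n + 3)"
    using pow[of x]
  proof eventually_elim
    case (elim n)
    have "rho (n + 3) = 2 ^ (n + 3) * cent (n + 2)"
      using rho_Suc_cent[of "n + 2"] by (simp add: numeral_3_eq_3)
    thus ?case using elim cent_pos[of "n + 2"] by (simp add: mult_right_mono less_imp_le)
  qed
  assume c: "0 < c"
  show "\<forall>\<^sub>F n in sequentially. y * rho (n + 2) \<le> c * cent (n + 2)"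
    using pow[of "y / c"]
  proof eventually_elim
    case (elim n)
    have "cent (n + 2) = 2 ^ (n + 3) * rho (n + 2)" by (simp add: cent_def numeral_3_eq_3)
    moreover have "y \<le> c * 2 ^ (n + 3)" using elim c by (simp add: field_simps)
    hence "y * rho (n + 2) \<le> c * 2 ^ (n + 3) * rho (n + 2)"
      using rho_pos[of "n + 2"] by (intro mult_right_mono) auto
    ultimately show ?case by (simp add: mult.assoc)
  qed
qed

text \<open>Harnack is applied to f^n / \<open>rho (n + 2)\<close> and to \<open>rho (n + 3)\<close>
  / f^n, whose moduli exceed 1 because the n-th iterate maps into \<open>ecomp n\<close>. Both tend
  to infinity at \<open>a\<close>, hence are eventually large enough at \<open>b\<close>.\<close>

lemma reaches_annulus_locally:
  assumes sub: "ball b \<delta> \<subseteq> ecomp 0" and a: "(annular_map ^^ N) a \<in> ann (N + 2)" "dist a b < \<delta> / 4"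
  shows "\<exists>n. (annular_map ^^ n) b \<in> ann (n + 2)"
proof -
  obtain c C where c: "0 < c" "0 < C" and growth: "\<forall>\<^sub>F n in sequentially.
    c * cent (n + 2) \<le> cmod ((annular_map ^^ n) a) \<and> cmod ((annular_map ^^ n) a) \<le> C * cent (n + 2)"
    using orbit_growth[OF a(1)] by blast
  have \<delta>: "0 < \<delta>" using a(2) zero_le_dist[of a b] by linarith
  have sub': "ball a (3 * \<delta> / 4) \<subseteq> ecomp 0"
  proof
    fix w assume "w \<in> ball a (3 * \<delta> / 4)"
    hence "w \<in> ball b \<delta>" using dist_triangle[of b w a] a(2) by (simp add: dist_commute)
    thus "w \<in> ecomp 0" using sub by blast
  qed
  have db: "dist a b \<le> 3 * \<delta> / 4 / 2" using a(2) \<delta> by simp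
  have bnd: "rho (n + 2) < cmod ((annular_map ^^ n) w)" "cmod ((annular_map ^^ n) w) < rho (n + 3)"
    if "w \<in> ball a (3 * \<delta> / 4)" for n w
    using ecomp_bounds[of "(annular_map ^^ n) w" n] ecomp_funpow[of n] sub' that by blast+
  have hol: "(annular_map ^^ n) holomorphic_on ball a (3 * \<delta> / 4)" for n
    using annular_map_holomorphic_ecomp sub' by (rule holomorphic_on_subset)
  \<comment> \<open>The annulus requires a factor strictly above 4 on both sides; 5 provides it at
    \<open>b\<close> and costs 5 ^ 3 at \<open>a\<close>.\<close>
  have "\<forall>\<^sub>F n in sequentially. (annular_map ^^ n) b \<in> ann (n + 2)"
    using growth eventually_rho_quotient[OF c(1), of "5 ^ 3"] eventually_cent_quotient[of "5 ^ 3 * C"]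
  proof eventually_elim
    case (elim n)
    have pos: "0 < rho (n + 2)" "0 < rho (n + 3)" by (rule rho_pos)+
    have nz: "(annular_map ^^ n) w \<noteq> 0" if "w \<in> ball a (3 * \<delta> / 4)" for w
      using bnd(1)[OF that, of n] pos by auto
    have bb: "b \<in> ball a (3 * \<delta> / 4)" and aa: "a \<in> ball a (3 * \<delta> / 4)" using db \<delta> by auto
    have "5 \<le> cmod ((annular_map ^^ n) b / of_real (rho (n + 2)))"
    proof (rule harnack_cube[where h = "\<lambda>w. (annular_map ^^ n) w / of_real (rho (n + 2))" and a = a])
      show "(\<lambda>w. (annular_map ^^ n) w / of_real (rho (n + 2))) holomorphic_on ball a (3 * \<delta> / 4)"
        using pos by (intro holomorphic_on_divide hol holomorphic_on_const) auto
      show "1 < cmod ((annular_map ^^ n) w / of_real (rho (n + 2)))" if "w \<in> ball a (3 * \<delta> / 4)" for w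
        using bnd(1)[OF that, of n] pos by (simp add: norm_divide)
      have "5 ^ 3 * rho (n + 2) \<le> cmod ((annular_map ^^ n) a)" using elim by linarith
      thus "5 ^ 3 \<le> cmod ((annular_map ^^ n) a / of_real (rho (n + 2)))"
        using pos by (simp add: norm_divide pos_le_divide_eq)
    qed (use db \<delta> in auto)
    hence lo: "5 * rho (n + 2) \<le> cmod ((annular_map ^^ n) b)"
      using pos by (simp add: norm_divide pos_le_divide_eq)
    have "5 \<le> cmod (of_real (rho (n + 3)) / (annular_map ^^ n) b)"
    proof (rule harnack_cube[where h = "\<lambda>w. of_real (rho (n + 3)) / (annular_map ^^ n) w" and a = a])
      show "(\<lambda>w. of_real (rho (n + 3)) / (annular_map ^^ n) w) holomorphic_on ball a (3 * \<delta> / 4)"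
        using nz by (intro holomorphic_on_divide hol holomorphic_on_const)
      show "1 < cmod (of_real (rho (n + 3)) / (annular_map ^^ n) w)" if "w \<in> ball a (3 * \<delta> / 4)" for w
        using bnd(2)[OF that, of n] nz[OF that] pos by (simp add: norm_divide)
      have "5 ^ 3 * cmod ((annular_map ^^ n) a) \<le> 5 ^ 3 * (C * cent (n + 2))"
        using elim by (intro mult_left_mono) auto
      also have "\<dots> \<le> rho (n + 3)" using elim by (simp add: mult.assoc)
      finally show "5 ^ 3 \<le> cmod (of_real (rho (n + 3)) / (annular_map ^^ n) a)"
        using pos nz[OF aa] by (simp add: norm_divide pos_le_divide_eq)
    qed (use db \<delta> in auto)
    hence hi: "5 * cmod ((annular_map ^^ n) b) \<le> rho (n + 3)"
      using pos nz[OF bb] by (simp add: norm_divide pos_le_divide_eq)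
    have eq: "Suc (n + 2) = n + 3" by simp
    have "0 < cmod ((annular_map ^^ n) b)" using nz[OF bb] by simp
    hence "cmod ((annular_map ^^ n) b) < rho (Suc (n + 2)) / 4" unfolding eq using hi by linarith
    moreover have "4 * rho (n + 2) < cmod ((annular_map ^^ n) b)" using lo pos(1) by linarith
    ultimately show ?case unfolding ann_def annulus_def by blast
  qed
  thus ?thesis using eventually_happens sequentially_bot by blast
qed

text \<open>The points whose orbits reach the annuli form an open set containing the centre; the
  local statement makes it closed in the connected component.\<close>

lemma all_orbits_reach_annulus:
  assumes "b \<in> ecomp 0"
  shows "\<exists>n. (annular_map ^^ n) b \<in> ann (n + 2)"
proof -
  define G where "G = {z \<in> ecomp 0. \<exists>n. (annular_map ^^ n) z \<in> ann (n + 2)}"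
  have "G = (\<Union>n. ecomp 0 \<inter> (annular_map ^^ n) -` ann (n + 2))" by (auto simp: G_def)
  also have "open \<dots>"
    by (intro open_UN ballI continuous_open_preimage holomorphic_on_imp_continuous_on
        annular_map_holomorphic_ecomp open_ecomp open_ann)
  finally have "open G" .
  hence "openin (top_of_set (ecomp 0)) G" by (intro open_subset) (auto simp: G_def)
  moreover have "closedin (top_of_set (ecomp 0)) G"
  proof -
    have "z \<in> G" if z: "z \<in> ecomp 0" "z \<in> closure G" for z
    proof -
      obtain \<delta> where \<delta>: "0 < \<delta>" "ball z \<delta> \<subseteq> ecomp 0" using open_ecomp z(1) openE by blast
      obtain a where a: "a \<in> G" "dist a z < \<delta> / 4"
        using z(2) \<delta>(1) unfolding closure_approachable by (meson divide_pos_pos zero_less_numeral)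
      thus "z \<in> G" using reaches_annulus_locally[OF \<delta>(2)] z(1) unfolding G_def by blast
    qed
    moreover have "G \<subseteq> ecomp 0" by (auto simp: G_def)
    ultimately have "ecomp 0 \<inter> closure G = G" using closure_subset[of G] by blast
    thus ?thesis unfolding closedin_Int_closure_of by simp
  qed
  moreover have "of_real (cent (0 + 2)) \<in> G"
    unfolding G_def using cent_in_ann[of 0] cent_in_ecomp[of 0] by (auto intro!: exI[of _ 0])
  ultimately have "G = ecomp 0" using connected_ecomp[of 0] unfolding connected_clopen by blast
  thus ?thesis using assms by (auto simp: G_def)
qed

section \<open>Wandering, comparable orbits and covered annuli\<close>

lemma iter_annular_map:
  assumes "z \<in> ecomp 0"
  shows "iter annular_map n (Some z) = Some ((annular_map ^^ n) z)"
  using assms ecomp_subset escaping_points_pole_free by (intro iter_Some) blast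

lemma iter_image_ecomp: "iter annular_map n ` Some ` ecomp 0 = Some ` ecomp n"
proof -
  have "iter annular_map n ` Some ` ecomp 0 = Some ` (annular_map ^^ n) ` ecomp 0"
    unfolding image_image by (rule image_cong) (simp_all add: iter_annular_map)
  thus ?thesis by (simp add: ecomp_funpow)
qed

lemma ecomp_wandering: "wandering_domain annular_map (Some ` ecomp 0)"
  unfolding wandering_domain_def
proof (intro conjI allI impI)
  note f = annular_map_nicely_meromorphic annular_map_not_rational
  show "Some ` ecomp 0 \<in> Fatou_components annular_map"
    by (rule escaping_component_Fatou_component[OF f ecomp_component])
  have im: "image_component annular_map (Some ` ecomp 0) n = Some ` ecomp n" for n
    by (rule image_component_eq[OF f ecomp_component]) (use iter_image_ecomp cent_in_ecomp in auto)
  \<comment> \<open>The moduli of components with different indices lie in disjoint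
    intervals.\<close>
  have lt: "ecomp m \<noteq> ecomp n" if "m < n" for m n
  proof
    assume eq: "ecomp m = ecomp n"
    have "rho (n + 2) < cmod (of_real (cent (n + 2)))" by (rule ecomp_bounds(1)[OF cent_in_ecomp])
    also have "\<dots> < rho (m + 3)" by (rule ecomp_bounds(2)) (simp only: eq cent_in_ecomp)
    also have "\<dots> \<le> rho (n + 2)" using that by (intro rho_mono) simp
    finally show False by simp
  qed
  show "image_component annular_map (Some ` ecomp 0) m \<noteq> image_component annular_map (Some ` ecomp 0) n"
    if "m \<noteq> n" for m n
    unfolding im using lt[of m n] lt[of n m] that
    by (auto simp: inj_image_eq_iff neq_iff)
qed

text \<open>Both orbits are eventually comparable with the same sequence
  \<open>cent (n + 2)\<close>, hence with each other.\<close>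

lemma ecomp_orbits_comparable:
  assumes "a \<in> Some ` ecomp 0" "b \<in> Some ` ecomp 0"
  shows "\<exists>M>1. \<forall>\<^sub>F n in sequentially.
    inverse M * sphere_abs (iter annular_map n a) \<le> sphere_abs (iter annular_map n b) \<and>
    sphere_abs (iter annular_map n b) \<le> M * sphere_abs (iter annular_map n a)"
proof -
  have half: "\<exists>K. \<forall>\<^sub>F n in sequentially. sphere_abs (iter annular_map n y) \<le> K * sphere_abs (iter annular_map n x)"
    if xy: "x \<in> Some ` ecomp 0" "y \<in> Some ` ecomp 0" for x y
  proof -
    obtain u v where uv: "x = Some u" "y = Some v" "u \<in> ecomp 0" "v \<in> ecomp 0" using xy by blast
    obtain c where c: "0 < c" "\<forall>\<^sub>F n in sequentially. c * cent (n + 2) \<le> cmod ((annular_map ^^ n) u)"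
      using all_orbits_reach_annulus[OF uv(3)] orbit_growth[of _ u] unfolding eventually_conj_iff by blast
    obtain C where C: "0 < C" "\<forall>\<^sub>F n in sequentially. cmod ((annular_map ^^ n) v) \<le> C * cent (n + 2)"
      using all_orbits_reach_annulus[OF uv(4)] orbit_growth[of _ v] unfolding eventually_conj_iff by blast
    have "\<forall>\<^sub>F n in sequentially. sphere_abs (iter annular_map n y) \<le> (C / c) * sphere_abs (iter annular_map n x)"
      using c(2) C(2)
    proof eventually_elim
      case (elim n)
      have "C * cent (n + 2) = (C / c) * (c * cent (n + 2))" using c(1) by simp
      also have "\<dots> \<le> (C / c) * cmod ((annular_map ^^ n) u)"
        using elim c(1) C(1) by (intro mult_left_mono) auto
      finally show ?case using elim uv by (simp add: iter_annular_map sphere_abs_def)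
    qed
    thus ?thesis by blast
  qed
  obtain K L where
    K: "\<forall>\<^sub>F n in sequentially. sphere_abs (iter annular_map n b) \<le> K * sphere_abs (iter annular_map n a)"
    and L: "\<forall>\<^sub>F n in sequentially. sphere_abs (iter annular_map n a) \<le> L * sphere_abs (iter annular_map n b)"
    using half assms by blast
  define M where "M = max 2 (max K L)"
  have M: "1 < M" "K \<le> M" "L \<le> M" by (auto simp: M_def)
  have "\<forall>\<^sub>F n in sequentially.
    inverse M * sphere_abs (iter annular_map n a) \<le> sphere_abs (iter annular_map n b) \<and>
    sphere_abs (iter annular_map n b) \<le> M * sphere_abs (iter annular_map n a)"
    using K L
  proof eventually_elim
    case (elim n)
    have pos: "0 \<le> sphere_abs x" for x by (simp add: sphere_abs_def)
    have "sphere_abs (iter annular_map n a) \<le> M * sphere_abs (iter annular_map n b)"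
      using elim(2) mult_right_mono[OF M(3) pos] by (rule order_trans)
    moreover have "sphere_abs (iter annular_map n b) \<le> M * sphere_abs (iter annular_map n a)"
      using elim(1) mult_right_mono[OF M(2) pos] by (rule order_trans)
    ultimately show ?case using M(1) by (simp add: field_simps)
  qed
  thus ?thesis using M(1) by blast
qed

theorem theorem1:
  shows "\<exists>f U. transcendental_meromorphic f \<and> wandering_domain f U \<and> escaping f U \<and>
    (\<exists>r R :: nat \<Rightarrow> real.
       (\<forall>\<^sub>F n in sequentially. 0 < r n \<and> r n < R n \<and> Some ` annulus (r n) (R n) \<subseteq> iter f n ` U) \<and>
       filterlim (\<lambda>n. R n / r n) at_top sequentially \<and>
       filterlim r at_top sequentially) \<and>
    (\<forall>a\<in>U. \<forall>b\<in>U. \<exists>M>1. \<forall>\<^sub>F n in sequentially.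
       inverse M * sphere_abs (iter f n a) \<le> sphere_abs (iter f n b) \<and>
       sphere_abs (iter f n b) \<le> M * sphere_abs (iter f n a))"
proof (rule exI[of _ annular_map], rule exI[of _ "Some ` ecomp 0"], intro conjI)
  \<comment> \<open>The middle annuli themselves: the ratio of their radii is 4^(n+3) / 16 =
    4^(n+1).\<close>
  define r R where "r n = 4 * rho (n + 2)" and "R n = rho (Suc (n + 2)) / 4" for n
  show "transcendental_meromorphic annular_map"
    unfolding transcendental_meromorphic_def
    using annular_map_nicely_meromorphic annular_map_not_rational by blast
  show "wandering_domain annular_map (Some ` ecomp 0)" by (rule ecomp_wandering)
  show "escaping annular_map (Some ` ecomp 0)" using ecomp_subset by (rule escaping_points_converge)
  have r0: "0 < r n" for n using rho_pos by (simp add: r_def)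
  have Rr: "R n / r n = 4 * 4 ^ n" for n
  proof -
    have "R n = 4 * 4 ^ n * r n" unfolding R_def r_def rho_Suc power_add by simp
    thus ?thesis using r0[of n] by simp
  qed
  have sub: "\<forall>\<^sub>F n in sequentially. 0 < r n \<and> r n < R n \<and>
    Some ` annulus (r n) (R n) \<subseteq> iter annular_map n ` Some ` ecomp 0"
  proof (rule always_eventually, intro allI conjI)
    fix n
    show "0 < r n" by (rule r0)
    have "1 < R n / r n" unfolding Rr using one_le_power[of "4::real" n] by linarith
    thus "r n < R n" using r0[of n] by (simp add: field_simps)
    have "annulus (r n) (R n) = ann (n + 2)" by (simp add: ann_def r_def R_def)
    thus "Some ` annulus (r n) (R n) \<subseteq> iter annular_map n ` Some ` ecomp 0"
      unfolding iter_image_ecomp using ann_subset_ecomp by blast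
  qed
  have "real n \<le> R n / r n" for n
  proof -
    have "real n \<le> 2 ^ n" using of_nat_less_two_power[of n, where 'a=real] by simp
    also have "\<dots> \<le> 4 ^ n" by (rule power_mono) auto
    finally show ?thesis unfolding Rr using zero_le_power[of "4::real" n] by linarith
  qed
  hence Rr_lim: "filterlim (\<lambda>n. R n / r n) at_top sequentially"
    by (intro filterlim_at_top_mono[OF filterlim_real_sequentially] always_eventually) blast
  have "real n \<le> r n" for n
    using rho_ge[of "n + 2"] by (simp add: r_def)
  hence "filterlim r at_top sequentially"
    by (intro filterlim_at_top_mono[OF filterlim_real_sequentially] always_eventually) blast
  with sub Rr_lim show "\<exists>r R :: nat \<Rightarrow> real.
       (\<forall>\<^sub>F n in sequentially. 0 < r n \<and> r n < R n \<and>
         Some ` annulus (r n) (R n) \<subseteq> iter annular_map n ` Some ` ecomp 0) \<and>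
       filterlim (\<lambda>n. R n / r n) at_top sequentially \<and>
       filterlim r at_top sequentially"
    by blast
  show "\<forall>a\<in>Some ` ecomp 0. \<forall>b\<in>Some ` ecomp 0. \<exists>M>1. \<forall>\<^sub>F n in sequentially.
      inverse M * sphere_abs (iter annular_map n a) \<le> sphere_abs (iter annular_map n b) \<and>
      sphere_abs (iter annular_map n b) \<le> M * sphere_abs (iter annular_map n a)"
    using ecomp_orbits_comparable by blast
qed

end
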